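(* For every $\epsilon>0$ there exists $\delta$ such that Dominating Set on $n$-vertex instances $G$ given with a $(3,\delta)$-hub of size $p$ cannot be solved in time $(2-\epsilon)^p\cdot|V(G)|^{\mathcal{O}(1)}$, unless the SCC fails.
   Context: For a graph $G$, a set $Q\subseteq V(G)$ is a $(\sigma,\delta)$-hub if every connected component of $G-Q$ has at most $\sigma$ vertices and is adjacent to at most $\delta$ vertices of $Q$. Dominating Set: given a graph $G$ (and integer $k$), find a minimum set $X\subseteq V(G)$ such that every vertex is in $X$ or adjacent to a vertex of $X$. $\le d$-Set Cover: given a universe $U$, a family $\mathcal{F}$ of subsets of $U$ of size at most $d$ with $\bigcup\mathcal{F}=U$, and an integer $t$, decide whether at most $t$ sets of $\mathcal{F}$ cover $U$. SCC: for all $\epsilon>0$ there is $d\ge1$ such that no algorithm solves every $\le d$-Set Cover instance in time $(2-\epsilon)^{|U|}|U|^{\mathcal{O}(1)}$. *)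

theory Defs
  imports
    Complex_Main
    "HOL-Library.Discrete_Functions"
    "Graph_Theory.Digraph_Component"
begin

section \<open>Algorithms: random access machines with logarithmic cost\<close>

text \<open>
  Algorithms are structured programs of a random access machine under the logarithmic cost
  criterion: every operation is charged the binary length of the numbers it handles, addresses
  included. Charging one unit per operation would not do, since multiplication then builds
  numbers of exponential length in linearly many steps. Up to factors polylogarithmic in the
  running time, which are polynomial in the input size for running times of the form
  \<open>c\<^sup>n n\<^sup>O\<^sup>(\<^sup>1\<^sup>)\<close>, the model agrees with the word RAM.

  The memory is a family of infinite arrays of naturals, of which a program can mention only
  finitely many; interleaving them in a single memory changes the cost by a constant factor.
\<close>

type_synonym state = "nat \<Rightarrow> nat \<Rightarrow> nat"

datatype aop = Add | Sub | Mul | Div | Less | Eq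

datatype aexp =
    Const nat
  | Read nat aexp  \<comment> \<open>array, index\<close>
  | Op aop aexp aexp

datatype com =
    SKIP
  | Write nat aexp aexp  \<comment> \<open>array, index, value\<close>
  | Seq com com
  | IfNZ aexp com com
  | WhileNZ aexp com

fun apply_op :: "aop \<Rightarrow> nat \<Rightarrow> nat \<Rightarrow> nat" where
  "apply_op Add x y = x + y"
| "apply_op Sub x y = x - y"
| "apply_op Mul x y = x * y"
| "apply_op Div x y = x div y"
| "apply_op Less x y = of_bool (x < y)"
| "apply_op Eq x y = of_bool (x = y)"

fun aval :: "aexp \<Rightarrow> state \<Rightarrow> nat" where
  "aval (Const n) s = n"
| "aval (Read a e) s = s a (aval e s)"
| "aval (Op f e1 e2) s = apply_op f (aval e1 s) (aval e2 s)"

text \<open>Since \<open>floor_log 0 = 0\<close>, the number \<open>0\<close> has length \<open>1\<close>.\<close>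

definition blen :: "nat \<Rightarrow> nat" where
  "blen x = floor_log x + 1"

fun acost :: "aexp \<Rightarrow> state \<Rightarrow> nat" where
  "acost (Const n) s = blen n"
| "acost (Read a e) s = acost e s + blen (aval e s) + blen (s a (aval e s))"
| "acost (Op f e1 e2) s = acost e1 s + acost e2 s + blen (aval e1 s) + blen (aval e2 s)"

text \<open>\<open>exec c s T s'\<close>: started in \<open>s\<close>, the program \<open>c\<close> halts in \<open>s'\<close> after time \<open>T\<close>.\<close>

inductive exec :: "com \<Rightarrow> state \<Rightarrow> nat \<Rightarrow> state \<Rightarrow> bool" where
  SKIP: "exec SKIP s 1 s"
| Write: "exec (Write a e1 e2) s
    (acost e1 s + acost e2 s + blen (aval e1 s) + blen (aval e2 s))
    (s(a := (s a)(aval e1 s := aval e2 s)))"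
| Seq: "exec c1 s T1 s' \<Longrightarrow> exec c2 s' T2 s'' \<Longrightarrow> exec (Seq c1 c2) s (T1 + T2) s''"
| IfTrue: "aval e s \<noteq> 0 \<Longrightarrow> exec c1 s T s' \<Longrightarrow>
    exec (IfNZ e c1 c2) s (acost e s + blen (aval e s) + T) s'"
| IfFalse: "aval e s = 0 \<Longrightarrow> exec c2 s T s' \<Longrightarrow>
    exec (IfNZ e c1 c2) s (acost e s + blen (aval e s) + T) s'"
| WhileTrue: "aval e s \<noteq> 0 \<Longrightarrow> exec c s T s' \<Longrightarrow> exec (WhileNZ e c) s' T' s'' \<Longrightarrow>
    exec (WhileNZ e c) s (acost e s + blen (aval e s) + T + T') s''"
| WhileFalse: "aval e s = 0 \<Longrightarrow> exec (WhileNZ e c) s (acost e s + blen (aval e s)) s"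

inductive_cases SKIP_E: "exec SKIP s T s'"
inductive_cases Write_E: "exec (Write a e1 e2) s T s'"
inductive_cases Seq_E: "exec (Seq c1 c2) s T s'"
inductive_cases IfNZ_E: "exec (IfNZ e c1 c2) s T s'"
inductive_cases WhileNZ_E: "exec (WhileNZ e c) s T s'"

lemma exec_deterministic:
  "exec c s T s' \<Longrightarrow> exec c s U u' \<Longrightarrow> U = T \<and> u' = s'"
proof (induction arbitrary: U u' rule: exec.induct)
  case (SKIP s)
  then show ?case by (rule SKIP_E) simp
next
  case (Write a e1 e2 s)
  then show ?case by (rule Write_E) simp
next
  case (Seq c1 s T1 s' c2 T2 s'')
  from Seq.prems obtain U1 U2 v where "exec c1 s U1 v" "exec c2 v U2 u'" "U = U1 + U2"
    by (auto elim: Seq_E)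
  with Seq.IH show ?case by metis
next
  case (IfTrue e s c1 T s' c2)
  from IfTrue.prems IfTrue.hyps obtain V
    where "U = acost e s + blen (aval e s) + V" "exec c1 s V u'"
    by (auto elim: IfNZ_E)
  with IfTrue.IH show ?case by metis
next
  case (IfFalse e s c2 T s' c1)
  from IfFalse.prems IfFalse.hyps obtain V
    where "U = acost e s + blen (aval e s) + V" "exec c2 s V u'"
    by (auto elim: IfNZ_E)
  with IfFalse.IH show ?case by metis
next
  case (WhileTrue e s c T s' T' s'')
  from WhileTrue.prems obtain V v V'
    where "U = acost e s + blen (aval e s) + V + V'" "exec c s V v" "exec (WhileNZ e c) v V' u'"
    by (rule WhileNZ_E) (use WhileTrue.hyps in simp_all)
  with WhileTrue.IH show ?case by metis
next
  case (WhileFalse e s c)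
  from WhileFalse.prems show ?case
    by (rule WhileNZ_E) (use WhileFalse.hyps in simp_all)
qed

lemma exec_time_pos: "exec c s T s' \<Longrightarrow> 0 < T"
  by (induction rule: exec.induct) (auto simp: blen_def)

text \<open>
  The input is read from array \<open>0\<close>. The answer is left in array \<open>1\<close>: its first cell for a decision
  problem, and the characteristic vector of the set found for a search problem on \<open>{..<n}\<close>.
\<close>

definition input :: "nat list \<Rightarrow> state" where
  "input xs = (\<lambda>a i. if a = 0 \<and> i < length xs then xs ! i else 0)"

definition accepting :: "state \<Rightarrow> bool" where
  "accepting s \<longleftrightarrow> s 1 0 \<noteq> 0"

definition output_set :: "nat \<Rightarrow> state \<Rightarrow> nat set" where
  "output_set n s = {v. v < n \<and> s 1 v \<noteq> 0}"


section \<open>Set Cover with sets of bounded size\<close>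

definition set_cover_instance :: "nat \<Rightarrow> 'a set \<Rightarrow> 'a set set \<Rightarrow> bool" where
  "set_cover_instance d U F \<longleftrightarrow>
     finite U \<and> (\<forall>S\<in>F. S \<subseteq> U \<and> card S \<le> d) \<and> \<Union>F = U"

definition has_set_cover :: "'a set \<Rightarrow> 'a set set \<Rightarrow> nat \<Rightarrow> bool" where
  "has_set_cover U F t \<longleftrightarrow> (\<exists>C\<subseteq>F. card C \<le> t \<and> \<Union>C = U)"

text \<open>The family is given by its incidence matrix, in row-major order.\<close>

definition encode_set_cover :: "nat \<Rightarrow> nat set list \<Rightarrow> nat \<Rightarrow> nat list" where
  "encode_set_cover n Fs t =
     [n, length Fs, t] @ concat (map (\<lambda>S. map (\<lambda>u. of_bool (u \<in> S)) [0..<n]) Fs)"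

text \<open>
  Instances have universe \<open>{..<n}\<close> and a family listed, in any order, without repetitions, so that
  their size is polynomial in \<open>n\<close> for fixed \<open>d\<close>. The budget is at most the number of sets: larger
  ones do not change the answer, but reading them would take time that is not bounded in \<open>n\<close>.
\<close>

definition solves_set_cover :: "nat \<Rightarrow> com \<Rightarrow> (nat \<Rightarrow> real) \<Rightarrow> bool" where
  "solves_set_cover d P time \<longleftrightarrow>
     (\<forall>n Fs t. set_cover_instance d {..<n} (set Fs) \<and> distinct Fs \<and> t \<le> length Fs \<longrightarrow>
       (\<exists>T s. exec P (input (encode_set_cover n Fs t)) T s \<and> real T \<le> time n \<and>
              (accepting s \<longleftrightarrow> has_set_cover {..<n} (set Fs) t)))"

text \<open>
  \<open>n\<^sup>O\<^sup>(\<^sup>1\<^sup>)\<close> is rendered as \<open>K (n + 1)\<^sup>c\<close>, as \<open>n\<^sup>c\<close> would leave no time at all for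
  instances with \<open>n = 0\<close>.
\<close>

definition SCC :: bool where
  "SCC \<longleftrightarrow>
     (\<forall>\<epsilon>>0. \<exists>d\<ge>1. \<not> (\<exists>P (K::real) (c::nat).
        solves_set_cover d P (\<lambda>n. (2 - \<epsilon>) ^ n * (K * (real n + 1) ^ c))))"


section \<open>Hubs and Dominating Set\<close>

text \<open>
  A finite simple graph is a \<^locale>\<open>pair_graph\<close>, that is, a finite, loop-free symmetric digraph. The
  strongly connected components of a symmetric digraph are the connected components of the
  undirected graph.
\<close>

definition is_hub :: "nat \<Rightarrow> nat \<Rightarrow> 'a pair_pre_digraph \<Rightarrow> 'a set \<Rightarrow> bool" where
  "is_hub \<sigma> \<delta> G Q \<longleftrightarrow> Q \<subseteq> pverts G \<and>
     (\<forall>C \<in> pre_digraph.sccs_verts (with_proj G \<restriction> (pverts G - Q)).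
        card C \<le> \<sigma> \<and> card {q \<in> Q. \<exists>v\<in>C. (v, q) \<in> parcs G} \<le> \<delta>)"

definition dominating_set :: "'a pair_pre_digraph \<Rightarrow> 'a set \<Rightarrow> bool" where
  "dominating_set G X \<longleftrightarrow> X \<subseteq> pverts G \<and>
     (\<forall>v\<in>pverts G. v \<in> X \<or> (\<exists>x\<in>X. (x, v) \<in> parcs G))"

definition minimum_dominating_set :: "'a pair_pre_digraph \<Rightarrow> 'a set \<Rightarrow> bool" where
  "minimum_dominating_set G X \<longleftrightarrow>
     dominating_set G X \<and> (\<forall>Y. dominating_set G Y \<longrightarrow> card X \<le> card Y)"

definition hub_instance :: "nat \<Rightarrow> nat \<Rightarrow> nat \<Rightarrow> nat pair_pre_digraph \<Rightarrow> nat set \<Rightarrow> bool" where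
  "hub_instance \<sigma> \<delta> n G Q \<longleftrightarrow> pair_graph G \<and> pverts G = {..<n} \<and> is_hub \<sigma> \<delta> G Q"

text \<open>The hub is given by its characteristic vector and the graph by its adjacency matrix.\<close>

definition encode_hub_graph :: "nat \<Rightarrow> nat pair_pre_digraph \<Rightarrow> nat set \<Rightarrow> nat list" where
  "encode_hub_graph n G Q =
     map (\<lambda>v. of_bool (v \<in> Q)) [0..<n] @
     concat (map (\<lambda>u. map (\<lambda>v. of_bool ((u, v) \<in> parcs G)) [0..<n]) [0..<n])"

text \<open>The time bound takes the size of the hub and the number of vertices.\<close>

definition solves_dominating_set ::
    "nat \<Rightarrow> nat \<Rightarrow> com \<Rightarrow> (nat \<Rightarrow> nat \<Rightarrow> real) \<Rightarrow> bool" where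
  "solves_dominating_set \<sigma> \<delta> P time \<longleftrightarrow>
     (\<forall>n G Q. hub_instance \<sigma> \<delta> n G Q \<longrightarrow>
       (\<exists>T s. exec P (input (n # encode_hub_graph n G Q)) T s \<and>
              real T \<le> time (card Q) n \<and>
              minimum_dominating_set G (output_set n s)))"

text \<open>In the decision version, the budget is bounded for the same reason as in Set Cover.\<close>

definition decides_dominating_set ::
    "nat \<Rightarrow> nat \<Rightarrow> com \<Rightarrow> (nat \<Rightarrow> nat \<Rightarrow> real) \<Rightarrow> bool" where
  "decides_dominating_set \<sigma> \<delta> P time \<longleftrightarrow>
     (\<forall>n G Q k. hub_instance \<sigma> \<delta> n G Q \<and> k \<le> n \<longrightarrow>
       (\<exists>T s. exec P (input (n # k # encode_hub_graph n G Q)) T s \<and>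
              real T \<le> time (card Q) n \<and>
              (accepting s \<longleftrightarrow> (\<exists>X. dominating_set G X \<and> card X \<le> k))))"

end

theory Submission
  imports Defs
begin

text \<open>
  Each set \<open>S\<^sub>j\<close> of a set cover instance on \<open>{..<n}\<close> with \<open>m\<close> sets becomes a path on the three
  vertices \<open>n + j\<close>, \<open>n + m + j\<close>, \<open>n + 2 m + j\<close>, whose first vertex is adjacent to the elements of
  \<open>S\<^sub>j\<close>. The elements form a hub of size exactly \<open>n\<close>, whose removal leaves the paths. Dominating the
  last vertices of the paths costs \<open>m\<close> vertices and may as well be done by the middle ones, which
  dominate the paths; every further vertex then does no better than the first vertex of a path.
  Hence a cover by \<open>t\<close> sets exists iff \<open>m + t\<close> vertices dominate the graph. As \<open>m \<le> (n + 1)\<^sup>d\<close>, the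
  graph has polynomial size in \<open>n\<close>.

  On the machine, the adjacency matrix is a function of the index computed by a loop-free expression,
  so a single loop writes the graph. A program for Dominating Set is then run unchanged, with the set
  cover instance and the loop counter kept in arrays that it does not mention.
\<close>

section \<open>The graph of a set cover instance\<close>

text \<open>Edges are oriented here and symmetrised in \<open>cover_graph\<close>. Both edges of a
  path are shifts by \<open>length Fs\<close>. For an empty family such a shift would be a loop, but
  then no vertex lies outside the hub.\<close>

definition cover_edge :: "nat \<Rightarrow> nat set list \<Rightarrow> nat \<Rightarrow> nat \<Rightarrow> bool" where
  "cover_edge n Fs u v \<longleftrightarrow>
     u < n \<and> n \<le> v \<and> v < n + length Fs \<and> u \<in> Fs ! (v - n) \<or> n \<le> u \<and> v = u + length Fs"

definition cover_graph :: "nat \<Rightarrow> nat set list \<Rightarrow> nat pair_pre_digraph" where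
  "cover_graph n Fs = \<lparr>pverts = {..<n + 3 * length Fs},
     parcs = {(u, v). u < n + 3 * length Fs \<and> v < n + 3 * length Fs \<and>
                      (cover_edge n Fs u v \<or> cover_edge n Fs v u)}\<rparr>"

lemma pverts_cover_graph [simp]: "pverts (cover_graph n Fs) = {..<n + 3 * length Fs}"
  by (simp add: cover_graph_def)

lemma parcs_cover_graph [simp]:
  "(u, v) \<in> parcs (cover_graph n Fs) \<longleftrightarrow> u < n + 3 * length Fs \<and> v < n + 3 * length Fs \<and>
     (cover_edge n Fs u v \<or> cover_edge n Fs v u)"
  by (simp add: cover_graph_def)

lemma pair_graph_cover_graph: "pair_graph (cover_graph n Fs)"
proof
  show "finite (parcs (cover_graph n Fs))"
    by (rule finite_subset[of _ "{..<n + 3 * length Fs} \<times> {..<n + 3 * length Fs}"]) auto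
  show "symmetric (with_proj (cover_graph n Fs))"
    by (auto simp: symmetric_def sym_def)
qed (auto simp: cover_edge_def)

section \<open>Components outside the hub\<close>

text \<open>The residue of \<open>v - n\<close> is the index of the path containing
  \<open>v\<close>; a shift by \<open>length Fs\<close> preserves it.\<close>

lemma cover_edge_outside_hub_mod:
  assumes "cover_edge n Fs u v" "n \<le> u"
  shows "(u - n) mod length Fs = (v - n) mod length Fs"
  using assms by (auto simp: cover_edge_def) (metis Nat.diff_add_assoc2 mod_add_self2)

text \<open>Every arc outside the hub preserves the path index, so a walk never leaves its
  path.\<close>

lemma reachable_cover_graph_minus_hub:
  assumes "u \<rightarrow>\<^sup>*\<^bsub>with_proj (cover_graph n Fs) \<restriction> (pverts (cover_graph n Fs) - {..<n})\<^esub> v"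
  shows "n \<le> v \<and> v < n + 3 * length Fs \<and> (u - n) mod length Fs = (v - n) mod length Fs"
  using assms unfolding reachable_def
proof (induction rule: rtrancl_on_induct)
  case base
  then show ?case by auto
next
  case (step v w)
  then have "n \<le> v" "n \<le> w" "w < n + 3 * length Fs" "cover_edge n Fs v w \<or> cover_edge n Fs w v"
    by (auto simp: arcs_ends_conv)
  with step.IH show ?case
    using cover_edge_outside_hub_mod by metis
qed

lemma is_hub_cover_graph:
  assumes "set_cover_instance d {..<n} (set Fs)"
  shows "is_hub 3 d (cover_graph n Fs) {..<n}"
  unfolding is_hub_def
proof (intro conjI ballI)
  show "{..<n} \<subseteq> pverts (cover_graph n Fs)" by auto
next
  let ?m = "length Fs"
  fix C assume C: "C \<in> pre_digraph.sccs_verts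
    (with_proj (cover_graph n Fs) \<restriction> (pverts (cover_graph n Fs) - {..<n}))"
  then obtain u where "u \<in> C" by (auto simp: pre_digraph.sccs_verts_def)
  define j where "j = (u - n) mod ?m"
  have C_mod: "n \<le> v \<and> v < n + 3 * ?m \<and> (v - n) mod ?m = j" if "v \<in> C" for v
    using reachable_cover_graph_minus_hub[of n Fs u v] C \<open>u \<in> C\<close> that
    by (auto simp: pre_digraph.sccs_verts_def j_def)
  \<comment> \<open>The vertex \<open>u\<close> lies between \<open>n\<close> and
    \<open>n + 3 * ?m\<close>, so \<open>?m\<close> is positive and the remainder is proper.\<close>
  then have "j < ?m" using \<open>u \<in> C\<close> by (metis add_lessD1 bot_nat_0.not_eq_extremum j_def
    mod_less_divisor mult_0_right add_0_right leD)
  have C_sub: "C \<subseteq> {n + j, n + ?m + j, n + 2 * ?m + j}"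
  proof
    fix v assume "v \<in> C"
    then have v: "n \<le> v" "v - n < 3 * ?m" "(v - n) mod ?m = j" using C_mod by force+
    \<comment> \<open>The quotient is the position on the path: 0, 1, 2 for the first, middle and
      last vertex.\<close>
    have "(v - n) div ?m < 3" using v(2) by (simp add: less_mult_imp_div_less)
    then have "(v - n) div ?m \<in> {0, 1, 2}" by auto
    moreover have "v = n + (v - n) div ?m * ?m + j"
      using v(1) v(3) by (metis add.assoc div_mult_mod_eq le_add_diff_inverse)
    ultimately show "v \<in> {n + j, n + ?m + j, n + 2 * ?m + j}" by auto
  qed
  then have "card C \<le> card {n + j, n + ?m + j, n + 2 * ?m + j}" by (intro card_mono) auto
  also have "\<dots> \<le> 3" by (simp add: card_insert_if)
  finally show "card C \<le> 3" .
  have F: "card (Fs ! j) \<le> d" "finite (Fs ! j)"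
    using assms \<open>j < ?m\<close> finite_subset[of "Fs ! j" "{..<n}"]
    by (auto simp: set_cover_instance_def)
  \<comment> \<open>Of the three possible vertices only \<open>n + j\<close> has neighbours among
    the elements, namely those of \<open>Fs ! j\<close>.\<close>
  have "{q \<in> {..<n}. \<exists>v\<in>C. (v, q) \<in> parcs (cover_graph n Fs)} \<subseteq> Fs ! j"
    using C_sub \<open>j < ?m\<close> by (auto simp: cover_edge_def)
  then show "card {q \<in> {..<n}. \<exists>v\<in>C. (v, q) \<in> parcs (cover_graph n Fs)} \<le> d"
    using F by (meson card_mono le_trans)
qed

lemma hub_instance_cover_graph:
  assumes "set_cover_instance d {..<n} (set Fs)"
  shows "hub_instance 3 d (n + 3 * length Fs) (cover_graph n Fs) {..<n}"
  using assms by (simp add: hub_instance_def pair_graph_cover_graph is_hub_cover_graph)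

section \<open>Covers versus dominating sets\<close>

text \<open>Take all middle vertices, which dominate the paths, and the first vertices belonging to
  the sets of the cover, which dominate the elements.\<close>

lemma dominating_set_of_set_cover:
  assumes "set_cover_instance d {..<n} (set Fs)" "distinct Fs" "has_set_cover {..<n} (set Fs) t"
  shows "\<exists>X. dominating_set (cover_graph n Fs) X \<and> card X \<le> length Fs + t"
proof -
  let ?m = "length Fs"
  obtain C where C: "C \<subseteq> set Fs" "card C \<le> t" "\<Union>C = {..<n}"
    using assms(3) by (auto simp: has_set_cover_def)
  define J where "J = {j. j < ?m \<and> Fs ! j \<in> C}"
  define X where "X = {n + ?m..<n + 2 * ?m} \<union> (+) n ` J"
  \<comment> \<open>Distinctness gives each set of the cover a single index.\<close>
  have "card J = card C"
  proof (rule bij_betw_same_card)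
    show "bij_betw ((!) Fs) J C"
      unfolding bij_betw_def
    proof
      show "inj_on ((!) Fs) J" using assms(2) by (auto simp: J_def inj_on_def nth_eq_iff_index_eq)
      show "(!) Fs ` J = C" using C(1) by (force simp: J_def in_set_conv_nth)
    qed
  qed
  have "card X \<le> card {n + ?m..<n + 2 * ?m} + card ((+) n ` J)"
    unfolding X_def by (rule card_Un_le)
  also have "card ((+) n ` J) = card C" using \<open>card J = card C\<close> by (simp add: card_image)
  finally have "card X \<le> ?m + t" using C(2) by simp
  moreover have "dominating_set (cover_graph n Fs) X"
    unfolding dominating_set_def
  proof (intro conjI ballI)
    show "X \<subseteq> pverts (cover_graph n Fs)" by (auto simp: X_def J_def)
  next
    fix v assume "v \<in> pverts (cover_graph n Fs)"
    then have "v < n + 3 * ?m" by simp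
    then consider "v < n" | "n \<le> v" "v < n + ?m" | "n + ?m \<le> v" "v < n + 2 * ?m"
      | "n + 2 * ?m \<le> v" "v < n + 3 * ?m" by linarith
    then show "v \<in> X \<or> (\<exists>x\<in>X. (x, v) \<in> parcs (cover_graph n Fs))"
    proof cases
      case 1
      then obtain S where "S \<in> C" "v \<in> S" using C(3) by auto
      moreover then obtain j where "j < ?m" "Fs ! j = S" using C(1) by (metis in_set_conv_nth subsetD)
      ultimately have "n + j \<in> X" "(n + j, v) \<in> parcs (cover_graph n Fs)"
        using 1 by (auto simp: X_def J_def cover_edge_def)
      then show ?thesis by blast
    next
      case 2
      then have "v + ?m \<in> X" "(v + ?m, v) \<in> parcs (cover_graph n Fs)"
        by (auto simp: X_def cover_edge_def)
      then show ?thesis by blast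
    next
      case 3
      then show ?thesis by (auto simp: X_def)
    next
      case 4
      then have "v - ?m \<in> X" "(v - ?m, v) \<in> parcs (cover_graph n Fs)"
        by (auto simp: X_def cover_edge_def)
      then show ?thesis by blast
    qed
  qed
  ultimately show ?thesis by blast
qed

text \<open>At least \<open>m\<close> vertices are spent on middle and last vertices, so at most
  \<open>t\<close> elements and first vertices remain. Each of these is exchanged for one set that
  covers every element it dominates.\<close>

lemma set_cover_of_dominating_set:
  assumes "set_cover_instance d {..<n} (set Fs)"
    and "dominating_set (cover_graph n Fs) X" "card X \<le> length Fs + t"
  shows "has_set_cover {..<n} (set Fs) t"
proof -
  let ?m = "length Fs"
  have X_sub: "X \<subseteq> {..<n + 3 * ?m}" using assms(2) by (simp add: dominating_set_def)
  then have "finite X" using finite_subset by blast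
  define Y where "Y = X \<inter> {n + ?m..}"
  define Z where "Z = X \<inter> {..<n + ?m}"
  have "card X = card Y + card Z"
    using \<open>finite X\<close> by (subst card_Un_disjoint[symmetric]) (auto simp: Y_def Z_def intro: arg_cong[where f = card])
  \<comment> \<open>The leaf \<open>n + 2 m + j\<close> is dominated only by itself and by \<open>n + m + j\<close>.\<close>
  moreover have "?m \<le> card Y"
  proof -
    \<comment> \<open>The middle and the last vertex of path \<open>j\<close> both have residue
      \<open>j\<close>, so every residue occurs in \<open>Y\<close>.\<close>
    have "{..<?m} \<subseteq> (\<lambda>y. (y - n) mod ?m) ` Y"
    proof
      fix j assume "j \<in> {..<?m}"
      then have "j < ?m" by simp
      then have "n + 2 * ?m + j \<in> pverts (cover_graph n Fs)" by simp
      then have "n + 2 * ?m + j \<in> X \<or> (\<exists>x\<in>X. (x, n + 2 * ?m + j) \<in> parcs (cover_graph n Fs))"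
        using assms(2) unfolding dominating_set_def by blast
      then have "n + 2 * ?m + j \<in> X \<or> n + ?m + j \<in> X"
        using \<open>j < ?m\<close> by (auto simp: cover_edge_def algebra_simps)
      then have "n + 2 * ?m + j \<in> Y \<or> n + ?m + j \<in> Y" by (simp add: Y_def)
      moreover have "j = (n + 2 * ?m + j - n) mod ?m" "j = (n + ?m + j - n) mod ?m"
        using \<open>j < ?m\<close> by (simp_all add: add.assoc)
      ultimately show "j \<in> (\<lambda>y. (y - n) mod ?m) ` Y" by blast
    qed
    then have "card {..<?m} \<le> card Y"
      using \<open>finite X\<close> by (intro surj_card_le) (auto simp: Y_def)
    then show ?thesis by simp
  qed
  ultimately have "card Z \<le> t" using assms(3) by linarith
  have "\<forall>u<n. \<exists>S\<in>set Fs. u \<in> S" using assms(1) by (auto simp: set_cover_instance_def)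
  then obtain g where g: "\<And>u. u < n \<Longrightarrow> g u \<in> set Fs \<and> u \<in> g u" by metis
  \<comment> \<open>Elements are pairwise nonadjacent: among the elements, a chosen element
    dominates only itself, so any set containing it will do.\<close>
  define f where "f z = (if z < n then g z else Fs ! (z - n))" for z
  have f_sub: "f ` Z \<subseteq> set Fs" using g by (auto simp: f_def Z_def)
  have "\<Union>(f ` Z) = {..<n}"
  proof
    show "\<Union>(f ` Z) \<subseteq> {..<n}" using f_sub assms(1) unfolding set_cover_instance_def by blast
  next
    show "{..<n} \<subseteq> \<Union>(f ` Z)"
    proof
      fix u assume "u \<in> {..<n}"
      then have "u < n" by simp
      then have "u \<in> X \<or> (\<exists>x\<in>X. (x, u) \<in> parcs (cover_graph n Fs))"
        using assms(2) by (simp add: dominating_set_def)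
      then have "\<exists>z\<in>Z. u \<in> f z"
      proof
        assume "u \<in> X"
        then show ?thesis using \<open>u < n\<close> g by (intro bexI[of _ u]) (auto simp: Z_def f_def)
      next
        assume "\<exists>x\<in>X. (x, u) \<in> parcs (cover_graph n Fs)"
        then obtain x where "x \<in> X" "n \<le> x" "x < n + ?m" "u \<in> Fs ! (x - n)"
          using \<open>u < n\<close> by (auto simp: cover_edge_def)
        then show ?thesis by (intro bexI[of _ x]) (auto simp: Z_def f_def)
      qed
      then show "u \<in> \<Union>(f ` Z)" by blast
    qed
  qed
  moreover have "card (f ` Z) \<le> t"
    using card_image_le[of Z f] \<open>card Z \<le> t\<close> \<open>finite X\<close> by (simp add: Z_def)
  ultimately show ?thesis using f_sub by (auto simp: has_set_cover_def)
qed

text \<open>A set of at most \<open>d\<close> elements is read off a word of length \<open>d\<close>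
  over the \<open>n + 1\<close> letters \<open>{..n}\<close>, and there are
  \<open>(n + 1) ^ d\<close> such words.\<close>

lemma length_set_cover_family_le:
  assumes "set_cover_instance d {..<n} (set Fs)" "distinct Fs"
  shows "length Fs \<le> (n + 1) ^ d"
proof -
  let ?L = "{xs. set xs \<subseteq> {..n} \<and> length xs = d}"
  have "set Fs \<subseteq> (\<lambda>xs. set xs \<inter> {..<n}) ` ?L"
  proof
    fix S assume "S \<in> set Fs"
    then have S: "S \<subseteq> {..<n}" "card S \<le> d" using assms(1) by (auto simp: set_cover_instance_def)
    then have "finite S" using finite_subset by blast
    then obtain xs where xs: "set xs = S" "distinct xs" using finite_distinct_list by blast
    then have "length xs \<le> d" using S(2) distinct_card by metis
    \<comment> \<open>The letter \<open>n\<close> is outside the universe: it pads short words and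
      disappears on intersecting with \<open>{..<n}\<close>.\<close>
    then have "xs @ replicate (d - length xs) n \<in> ?L"
      using xs S(1) by (auto simp: set_replicate_conv_if split: if_splits)
    moreover have "set (xs @ replicate (d - length xs) n) \<inter> {..<n} = S"
      using xs S(1) by auto
    ultimately show "S \<in> (\<lambda>xs. set xs \<inter> {..<n}) ` ?L" by blast
  qed
  then have "card (set Fs) \<le> card ?L"
    by (intro surj_card_le) (auto intro: finite_lists_length_eq)
  then show ?thesis using assms(2) by (simp add: distinct_card card_lists_length_eq)
qed

section \<open>Cost of expressions and loops\<close>

lemma less_two_power_blen: "x < 2 ^ blen x"
  using floor_log_exp2_gt[of x] by (simp add: blen_def)

lemma blen_pos: "0 < blen x"
  by (simp add: blen_def)

lemma blen_leI:
  assumes "x < 2 ^ k" "0 < k"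
  shows "blen x \<le> k"
proof (cases "x = 0")
  case False
  then have "2 ^ floor_log x < (2::nat) ^ k"
    using floor_log_exp2_le[of x] assms(1) by linarith
  then show ?thesis by (simp add: blen_def)
qed (use assms in \<open>simp add: blen_def\<close>)

text \<open>From \<open>x < k < 2 ^ k\<close>. The bound is crude, but only polynomial overhead
  matters.\<close>

lemma blen_le: "x < k \<Longrightarrow> blen x \<le> k"
  by (rule blen_leI) (auto intro: less_trans less_exp)

lemma blen_mono: "x \<le> y \<Longrightarrow> blen x \<le> blen y"
  by (simp add: blen_def floor_log_le_iff)

text \<open>Sum and product are both below \<open>(x + 1) * (y + 1)\<close>, which is at most
  \<open>2 ^ (blen x + blen y)\<close>; the other operations return at most \<open>x\<close> or a
  truth value.\<close>

lemma blen_apply_op: "blen (apply_op f x y) \<le> blen x + blen y"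
proof -
  have "x + 1 \<le> 2 ^ blen x" "y + 1 \<le> 2 ^ blen y"
    using less_two_power_blen[of x] less_two_power_blen[of y] by simp_all
  then have *: "(x + 1) * (y + 1) \<le> 2 ^ (blen x + blen y)"
    unfolding power_add by (rule mult_le_mono)
  have le_left: "blen z \<le> blen x + blen y" if "z \<le> x" for z
    using blen_mono[OF that] by simp
  have "blen (of_bool b) = 1" for b by (simp add: blen_def)
  then have bool: "blen (of_bool b) \<le> blen x + blen y" for b
    using blen_pos[of x] by simp
  show ?thesis
  proof (cases f)
    case Add
    have "x + y < (x + 1) * (y + 1)" by (simp add: algebra_simps)
    with * show ?thesis using Add by (intro blen_leI) (auto simp: blen_pos)
  next
    case Mul
    have "x * y < (x + 1) * (y + 1)" by (simp add: algebra_simps)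
    with * show ?thesis using Mul by (intro blen_leI) (auto simp: blen_pos)
  qed (use le_left bool in \<open>auto simp: div_le_dividend\<close>)
qed

text \<open>A state-independent factor that, times a bound on the length of all cells, bounds the
  cost of an expression plus the length of its value. The doubling for \<open>Op\<close> pays for
  the result, which may be as long as both operands together.\<close>

fun weight :: "aexp \<Rightarrow> nat" where
  "weight (Const n) = 2 * blen n"
| "weight (Read a e) = weight e + 2"
| "weight (Op f e1 e2) = 2 * (weight e1 + weight e2)"

text \<open>Cost and value length are bounded together because an operation is charged for the
  lengths of its operands.\<close>

lemma acost_le_weight:
  assumes "\<And>a i. blen (s a i) \<le> B"
  shows "acost e s + blen (aval e s) \<le> weight e * B"
proof (induction e)
  case (Const n)
  have "1 \<le> B" using assms[of 0 0] blen_pos[of "s 0 0"] by linarith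
  then show ?case by (cases B) simp_all
next
  case (Read a e)
  then show ?case using assms[of a "aval e s"] by (simp add: algebra_simps)
next
  case (Op f e1 e2)
  then show ?case using blen_apply_op[of f "aval e1 s" "aval e2 s"] by (simp add: algebra_simps)
qed

abbreviation (input) Var :: "nat \<Rightarrow> aexp" where
  "Var r \<equiv> Read r (Const 0)"

definition for_loop :: "nat \<Rightarrow> aexp \<Rightarrow> nat \<Rightarrow> aexp \<Rightarrow> aexp \<Rightarrow> com" where
  "for_loop r L a ix e = Seq (Write r (Const 0) (Const 0))
     (WhileNZ (Op Less (Var r) L)
       (Seq (Write a ix e) (Write r (Const 0) (Op Add (Var r) (Const 1)))))"

text \<open>The 4 pays for resetting the counter. As \<open>weight\<close> ignores array numbers,
  \<open>Var 0\<close> stands for the counter in any array.\<close>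

definition loop_weight :: "aexp \<Rightarrow> aexp \<Rightarrow> aexp \<Rightarrow> nat" where
  "loop_weight L ix e = 4 + weight (Op Less (Var 0) L) + weight ix + weight e +
     weight (Const 0) + weight (Op Add (Var 0) (Const 1))"

lemma exec_Write:
  assumes "aval e1 s = i" "aval e2 s = v" "\<And>a i. blen (s a i) \<le> B"
  shows "\<exists>T. exec (Write a e1 e2) s T (s(a := (s a)(i := v))) \<and> T \<le> (weight e1 + weight e2) * B"
  using exec.Write[of a e1 e2 s] assms(1,2)
    acost_le_weight[of s B e1, OF assms(3)] acost_le_weight[of s B e2, OF assms(3)]
  by (intro exI conjI) (auto simp: algebra_simps)

text \<open>The function \<open>g k\<close> is the content of array \<open>a\<close> after
  \<open>k\<close> rounds, and \<open>st\<close> is the state at that time. All numbers have length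
  at most \<open>B\<close>, so a round costs a constant times \<open>B\<close>.\<close>

lemma exec_for_loop:
  fixes g :: "nat \<Rightarrow> nat \<Rightarrow> nat"
  defines "st \<equiv> \<lambda>s r a k. s(r := (s r)(0 := k), a := g k)"
  assumes "r \<noteq> a" "g 0 = s a"
    and L: "\<And>k. k \<le> l \<Longrightarrow> aval L (st s r a k) = l"
    and step: "\<And>k. k < l \<Longrightarrow> (g k)(aval ix (st s r a k) := aval e (st s r a k)) = g (Suc k)"
    and Bs: "\<And>b i. blen (s b i) \<le> B" and Bg: "\<And>k i. k \<le> l \<Longrightarrow> blen (g k i) \<le> B"
    and Bl: "blen l \<le> B"
  shows "\<exists>T. exec (for_loop r L a ix e) s T (st s r a l) \<and> T \<le> loop_weight L ix e * (l + 1) * B"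
proof -
  let ?st = "st s r a"
  let ?test = "Op Less (Var r) L"
  let ?inc = "Write r (Const 0) (Op Add (Var r) (Const 1))"
  let ?body = "Seq (Write a ix e) ?inc"
  define W where "W = weight ?test + weight ix + weight e + weight (Const 0)
    + weight (Op Add (Var 0) (Const 1))"
  \<comment> \<open>Two indices are needed: between the write and the increment, the counter is
    \<open>k\<close> while the array is already \<open>g (Suc k)\<close>.\<close>
  have B_st: "blen ((s(r := (s r)(0 := k), a := g k')) b i) \<le> B" if "k \<le> l" "k' \<le> l" for k k' b i
    using that Bs Bg Bl blen_mono[of k l] by (auto intro: le_trans)
  \<comment> \<open>Downward induction on the counter: \<open>l - k\<close> rounds remain, followed
    by one failing test.\<close>
  have while: "\<exists>T. exec (WhileNZ ?test ?body) (?st k) T (?st l) \<and>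
      T \<le> weight ?test * B + (l - k) * (W * B)" if "k \<le> l" for k
    using that
  proof (induction rule: inc_induct)
    case base
    have "aval ?test (?st l) = 0" using L[of l] \<open>r \<noteq> a\<close> by (simp add: st_def)
    moreover have "acost ?test (?st l) + blen (aval ?test (?st l)) \<le> weight ?test * B"
      by (rule acost_le_weight) (use B_st in \<open>simp add: st_def\<close>)
    ultimately show ?case using exec.WhileFalse[of ?test "?st l" ?body] by auto
  next
    case (step k)
    then obtain T3 where T3: "exec (WhileNZ ?test ?body) (?st (Suc k)) T3 (?st l)"
      "T3 \<le> weight ?test * B + (l - Suc k) * (W * B)" by blast
    define s1 where "s1 = s(r := (s r)(0 := k), a := g (Suc k))"
    have test: "aval ?test (?st k) \<noteq> 0" using L[of k] \<open>r \<noteq> a\<close> step.hyps by (simp add: st_def)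
    have cost: "acost ?test (?st k) + blen (aval ?test (?st k)) \<le> weight ?test * B"
      by (rule acost_le_weight) (use B_st step.hyps in \<open>simp add: st_def\<close>)
    have "(?st k)(a := (?st k a)(aval ix (?st k) := aval e (?st k))) = s1"
      using assms(5)[of k] step.hyps by (simp add: st_def s1_def)
    then obtain T1 where T1: "exec (Write a ix e) (?st k) T1 s1" "T1 \<le> (weight ix + weight e) * B"
      using exec_Write[of ix "?st k" _ e _ B a] B_st step.hyps by (fastforce simp: st_def)
    have "s1(r := (s1 r)(0 := Suc k)) = ?st (Suc k)"
      using \<open>r \<noteq> a\<close> by (auto simp: st_def s1_def fun_eq_iff)
    moreover have "aval (Op Add (Var r) (Const 1)) s1 = Suc k" using \<open>r \<noteq> a\<close> by (simp add: s1_def)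
    ultimately obtain T2 where T2: "exec ?inc s1 T2 (?st (Suc k))"
      "T2 \<le> (weight (Const 0) + weight (Op Add (Var r) (Const 1))) * B"
      using exec_Write[of "Const 0" s1 0 "Op Add (Var r) (Const 1)" "Suc k" B r] B_st step.hyps
      by (auto simp: s1_def)
    have "exec (WhileNZ ?test ?body) (?st k)
        (acost ?test (?st k) + blen (aval ?test (?st k)) + (T1 + T2) + T3) (?st l)"
      by (rule exec.WhileTrue[OF test exec.Seq[OF T1(1) T2(1)] T3(1)])
    moreover have "acost ?test (?st k) + blen (aval ?test (?st k)) + (T1 + T2) \<le> W * B"
      using cost T1(2) T2(2) by (simp add: W_def algebra_simps)
    moreover have "(l - k) * (W * B) = W * B + (l - Suc k) * (W * B)"
      using step.hyps by (simp add: Suc_diff_Suc[symmetric])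
    ultimately show ?case using T3(2) by (intro exI conjI) auto
  qed
  have "\<exists>T. exec (Write r (Const 0) (Const 0)) s T (s(r := (s r)(0 := 0))) \<and>
      T \<le> (weight (Const 0) + weight (Const 0)) * B"
    by (rule exec_Write) (auto intro: Bs)
  moreover have "s(r := (s r)(0 := 0)) = ?st 0" using assms(2,3) by (auto simp: st_def fun_eq_iff)
  ultimately obtain T1 where T1: "exec (Write r (Const 0) (Const 0)) s T1 (?st 0)" "T1 \<le> 4 * B"
    by (auto simp: blen_def)
  obtain T2 where T2: "exec (WhileNZ ?test ?body) (?st 0) T2 (?st l)"
      "T2 \<le> weight ?test * B + l * (W * B)"
    using while[of 0] by auto
  have "T1 + T2 \<le> 4 * B + weight ?test * B + l * (W * B)" using T1(2) T2(2) by simp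
  also have "\<dots> \<le> loop_weight L ix e * B + l * (loop_weight L ix e * B)"
    unfolding loop_weight_def W_def by (intro add_mono mult_le_mono) (simp_all add: algebra_simps)
  also have "\<dots> = loop_weight L ix e * (l + 1) * B" by (simp add: algebra_simps)
  finally show ?thesis
    using exec.Seq[OF T1(1) T2(1)] unfolding for_loop_def by blast
qed

section \<open>Running a program next to unrelated arrays\<close>

fun aexp_arrays :: "aexp \<Rightarrow> nat set" where
  "aexp_arrays (Const n) = {}"
| "aexp_arrays (Read a e) = insert a (aexp_arrays e)"
| "aexp_arrays (Op f e1 e2) = aexp_arrays e1 \<union> aexp_arrays e2"

fun com_arrays :: "com \<Rightarrow> nat set" where
  "com_arrays SKIP = {}"
| "com_arrays (Write a e1 e2) = insert a (aexp_arrays e1 \<union> aexp_arrays e2)"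
| "com_arrays (Seq c1 c2) = com_arrays c1 \<union> com_arrays c2"
| "com_arrays (IfNZ e c1 c2) = aexp_arrays e \<union> com_arrays c1 \<union> com_arrays c2"
| "com_arrays (WhileNZ e c) = aexp_arrays e \<union> com_arrays c"

lemma finite_aexp_arrays: "finite (aexp_arrays e)"
  by (induction e) auto

lemma finite_com_arrays: "finite (com_arrays c)"
  by (induction c) (auto simp: finite_aexp_arrays)

lemma ex_fresh_array: "\<exists>x\<ge>2. com_arrays c \<subseteq> {..<x}"
proof -
  obtain k where "\<forall>a\<in>com_arrays c. a < k"
    using finite_com_arrays[of c] by (meson finite_nat_set_iff_bounded)
  then show ?thesis by (intro exI[of _ "k + 2"]) auto
qed

lemma aval_acost_cong:
  assumes "aexp_arrays e \<subseteq> A" "\<forall>a\<in>A. s a = u a"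
  shows "aval e s = aval e u" and "acost e s = acost e u"
  using assms by (induction e) auto

text \<open>A run sees only the arrays that its program mentions. Indices within an array do not
  change, so neither does the logarithmic cost.\<close>

lemma exec_frame:
  assumes "exec c s T s'" "com_arrays c \<subseteq> A" "\<forall>a\<in>A. s a = u a"
  shows "\<exists>u'. exec c u T u' \<and> (\<forall>a\<in>A. s' a = u' a) \<and> (\<forall>a. a \<notin> A \<longrightarrow> u' a = u a)"
  using assms
proof (induction arbitrary: u rule: exec.induct)
  case (SKIP s)
  then show ?case using exec.SKIP[of u] by (intro exI[of _ u]) simp
next
  case (Write a e1 e2 s)
  then have sub: "aexp_arrays e1 \<subseteq> A" "aexp_arrays e2 \<subseteq> A" "a \<in> A" by auto
  note e = aval_acost_cong[OF sub(1) Write.prems(2)] aval_acost_cong[OF sub(2) Write.prems(2)]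
  have "exec (Write a e1 e2) u (acost e1 s + acost e2 s + blen (aval e1 s) + blen (aval e2 s))
      (u(a := (u a)(aval e1 s := aval e2 s)))"
    unfolding e by (rule exec.Write)
  then show ?case using sub(3) Write.prems(2) by (intro exI conjI) (assumption, auto)
next
  case (Seq c1 s T1 s' c2 T2 s'')
  have sub: "com_arrays c1 \<subseteq> A" "com_arrays c2 \<subseteq> A" using Seq.prems(1) by auto
  obtain u' where u': "exec c1 u T1 u'" "\<forall>a\<in>A. s' a = u' a" "\<forall>a. a \<notin> A \<longrightarrow> u' a = u a"
    using Seq.IH(1)[OF sub(1) Seq.prems(2)] by blast
  obtain u'' where u'': "exec c2 u' T2 u''" "\<forall>a\<in>A. s'' a = u'' a" "\<forall>a. a \<notin> A \<longrightarrow> u'' a = u' a"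
    using Seq.IH(2)[OF sub(2) u'(2)] by blast
  show ?case using exec.Seq[OF u'(1) u''(1)] u'(3) u''(2,3) by (intro exI[of _ u'']) simp
next
  case (IfTrue e s c1 T s' c2)
  have sub: "aexp_arrays e \<subseteq> A" "com_arrays c1 \<subseteq> A" using IfTrue.prems(1) by auto
  note e = aval_acost_cong[OF sub(1) IfTrue.prems(2)]
  obtain u' where "exec c1 u T u'" "\<forall>a\<in>A. s' a = u' a" "\<forall>a. a \<notin> A \<longrightarrow> u' a = u a"
    using IfTrue.IH[OF sub(2) IfTrue.prems(2)] by blast
  then show ?case using exec.IfTrue[of e u c1 T u' c2] IfTrue.hyps(1)
    by (intro exI[of _ u']) (simp add: e)
next
  case (IfFalse e s c2 T s' c1)
  have sub: "aexp_arrays e \<subseteq> A" "com_arrays c2 \<subseteq> A" using IfFalse.prems(1) by auto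
  note e = aval_acost_cong[OF sub(1) IfFalse.prems(2)]
  obtain u' where "exec c2 u T u'" "\<forall>a\<in>A. s' a = u' a" "\<forall>a. a \<notin> A \<longrightarrow> u' a = u a"
    using IfFalse.IH[OF sub(2) IfFalse.prems(2)] by blast
  then show ?case using exec.IfFalse[of e u c2 T u' c1] IfFalse.hyps(1)
    by (intro exI[of _ u']) (simp add: e)
next
  case (WhileTrue e s c T s' T' s'')
  have sub: "aexp_arrays e \<subseteq> A" "com_arrays c \<subseteq> A" using WhileTrue.prems(1) by auto
  note e = aval_acost_cong[OF sub(1) WhileTrue.prems(2)]
  obtain u' where u': "exec c u T u'" "\<forall>a\<in>A. s' a = u' a" "\<forall>a. a \<notin> A \<longrightarrow> u' a = u a"
    using WhileTrue.IH(1)[OF sub(2) WhileTrue.prems(2)] by blast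
  obtain u'' where u'': "exec (WhileNZ e c) u' T' u''" "\<forall>a\<in>A. s'' a = u'' a"
      "\<forall>a. a \<notin> A \<longrightarrow> u'' a = u' a"
    using WhileTrue.IH(2)[OF WhileTrue.prems(1) u'(2)] by blast
  show ?case using exec.WhileTrue[OF _ u'(1) u''(1)] WhileTrue.hyps(1) u'(3) u''(2,3)
    by (intro exI[of _ u'']) (simp add: e)
next
  case (WhileFalse e s c)
  have "aexp_arrays e \<subseteq> A" using WhileFalse.prems(1) by simp
  note e = aval_acost_cong[OF this WhileFalse.prems(2)]
  show ?case using exec.WhileFalse[of e u c] WhileFalse.hyps WhileFalse.prems(2)
    by (intro exI[of _ u]) (simp add: e)
qed

text \<open>Each write is charged the length of the value written. This bounds the cells left behind
  by an arbitrary program.\<close>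

lemma exec_blen_le_time:
  "exec c s T s' \<Longrightarrow> s' a i = s a i \<or> blen (s' a i) \<le> T"
proof (induction rule: exec.induct)
  case (Seq c1 s T1 s' c2 T2 s'')
  then show ?case by (metis le_add1 le_add2 le_trans)
next
  case (WhileTrue e s c T s' T' s'')
  then show ?case by (metis add.commute le_add1 le_trans trans_le_add1)
qed auto

section \<open>Computing the graph\<close>

lemma nth_concat_map:
  assumes "i < length us" "j < n"
  shows "concat (map (\<lambda>u. map (f u) [0..<n]) us) ! (i * n + j) = f (us ! i) j"
  using assms
proof (induction us arbitrary: i)
  case (Cons u us)
  then show ?case by (cases i) (simp_all add: nth_append algebra_simps)
qed simp

lemma length_concat_map: "length (concat (map (\<lambda>u. map (f u) [0..<n]) us)) = length us * n"
  by (induction us) simp_all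

lemma input_0: "input xs 0 = (\<lambda>i. if i < length xs then xs ! i else 0)"
  by (simp add: input_def)

lemma input_neq_0: "a \<noteq> 0 \<Longrightarrow> input xs a = (\<lambda>_. 0)"
  by (simp add: input_def)

lemma length_encode_set_cover: "length (encode_set_cover n Fs t) = 3 + length Fs * n"
  by (simp add: encode_set_cover_def length_concat_map)

lemma input_encode_set_cover:
  "input (encode_set_cover n Fs t) 0 0 = n"
  "input (encode_set_cover n Fs t) 0 (Suc 0) = length Fs"
  "input (encode_set_cover n Fs t) 0 2 = t"
  by (simp_all add: input_0 length_encode_set_cover) (simp_all add: encode_set_cover_def)

lemma input_encode_set_cover_entry:
  assumes "j < length Fs" "u < n"
  shows "input (encode_set_cover n Fs t) 0 (3 + (j * n + u)) = of_bool (u \<in> Fs ! j)"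
proof -
  have "j * n + u < Suc j * n" using assms(2) by simp
  also have "\<dots> \<le> length Fs * n" using assms(1) by (intro mult_le_mono1) simp
  finally have "3 + (j * n + u) < length (encode_set_cover n Fs t)"
    by (simp add: length_encode_set_cover)
  moreover have "encode_set_cover n Fs t ! (3 + (j * n + u)) = of_bool (u \<in> Fs ! j)"
    unfolding encode_set_cover_def
    by (subst nth_append_right) (simp_all add: nth_concat_map[OF assms])
  ultimately show ?thesis by (simp add: input_0)
qed

lemma set_encode_set_cover:
  "set (encode_set_cover n Fs t) \<subseteq> {n, length Fs, t, 0, 1}"
  by (auto simp: encode_set_cover_def)

lemma length_encode_hub_graph: "length (encode_hub_graph n G Q) = n + n * n"
  by (simp add: encode_hub_graph_def length_concat_map)

lemma set_encode_hub_graph: "set (encode_hub_graph n G Q) \<subseteq> {0, 1}"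
  by (auto simp: encode_hub_graph_def)

lemma nth_encode_hub_graph:
  assumes "j < n + n * n"
  shows "encode_hub_graph n G Q ! j =
    (if j < n then of_bool (j \<in> Q) else of_bool (((j - n) div n, (j - n) mod n) \<in> parcs G))"
proof (cases "j < n")
  case True
  then show ?thesis by (simp add: encode_hub_graph_def nth_append)
next
  case False
  then have "j - n < n * n" using assms by simp
  then have "(j - n) div n < n" "(j - n) mod n < n"
    using less_mult_imp_div_less by (auto intro!: mod_less_divisor intro: gr0I)
  then have "concat (map (\<lambda>u. map (\<lambda>v. of_bool ((u, v) \<in> parcs G)) [0..<n]) [0..<n]) !
      ((j - n) div n * n + (j - n) mod n) = (of_bool (((j - n) div n, (j - n) mod n) \<in> parcs G) :: nat)"
    by (subst nth_concat_map) simp_all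
  then show ?thesis using False by (simp add: encode_hub_graph_def nth_append)
qed

text \<open>The number \<open>h\<close> selects the header: \<open>1\<close> for the search and \<open>2\<close> for the decision problem.\<close>

definition hub_input :: "nat \<Rightarrow> nat \<Rightarrow> nat set list \<Rightarrow> nat \<Rightarrow> nat list" where
  "hub_input h n Fs t = take h [n + 3 * length Fs, length Fs + t] @
     encode_hub_graph (n + 3 * length Fs) (cover_graph n Fs) {..<n}"

section \<open>Expressions for the cells of the graph encoding\<close>

definition order_exp :: "nat \<Rightarrow> aexp" where
  "order_exp x = Op Add (Var x) (Op Mul (Const 3) (Read x (Const 1)))"

definition budget_exp :: "nat \<Rightarrow> aexp" where
  "budget_exp x = Op Add (Read x (Const 1)) (Read x (Const 2))"

text \<open>Conjunction is a product, negation is \<open>1 - _\<close>, and the sum is a disjunction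
  of exclusive cases. The offset 3 skips the header of the encoded instance.\<close>

definition edge_exp :: "nat \<Rightarrow> aexp \<Rightarrow> aexp \<Rightarrow> aexp" where
  "edge_exp x u v = Op Add
     (Op Mul (Op Mul (Op Less u (Var x)) (Op Sub (Const 1) (Op Less v (Var x))))
       (Op Mul (Op Less v (Op Add (Var x) (Read x (Const 1))))
         (Read x (Op Add (Const 3) (Op Add (Op Mul (Op Sub v (Var x)) (Var x)) u)))))
     (Op Mul (Op Sub (Const 1) (Op Less u (Var x))) (Op Eq v (Op Add u (Read x (Const 1)))))"

definition adjacency_exp :: "nat \<Rightarrow> aexp \<Rightarrow> aexp \<Rightarrow> aexp" where
  "adjacency_exp x u v = Op Less (Const 0) (Op Add (edge_exp x u v) (edge_exp x v u))"

text \<open>The machine has no remainder operation, so the column is the index minus row times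
  order.\<close>

definition entry_exp :: "nat \<Rightarrow> aexp \<Rightarrow> aexp" where
  "entry_exp x j = (let k = Op Sub j (order_exp x); u = Op Div k (order_exp x) in Op Add
     (Op Mul (Op Less j (order_exp x)) (Op Less j (Var x)))
     (Op Mul (Op Sub (Const 1) (Op Less j (order_exp x)))
       (adjacency_exp x u (Op Sub k (Op Mul u (order_exp x))))))"

text \<open>The factor \<open>h - 1\<close> switches the budget cell on for the decision header and
  off for the search header.\<close>

definition cell_exp :: "nat \<Rightarrow> nat \<Rightarrow> aexp \<Rightarrow> aexp" where
  "cell_exp h x i = Op Add (Op Mul (Op Eq i (Const 0)) (order_exp x))
     (Op Add (Op Mul (Op Mul (Op Eq i (Const 1)) (Const (h - 1))) (budget_exp x))
       (Op Mul (Op Sub (Const 1) (Op Less i (Const h))) (entry_exp x (Op Sub i (Const h)))))"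

lemma aval_order_exp:
  assumes "s x = input (encode_set_cover n Fs t) 0"
  shows "aval (order_exp x) s = n + 3 * length Fs"
  using assms by (simp add: order_exp_def input_encode_set_cover)

lemma aval_budget_exp:
  assumes "s x = input (encode_set_cover n Fs t) 0"
  shows "aval (budget_exp x) s = length Fs + t"
  using assms by (simp add: budget_exp_def input_encode_set_cover)

lemma aval_edge_exp:
  assumes "s x = input (encode_set_cover n Fs t) 0"
  shows "aval (edge_exp x u v) s = of_bool (cover_edge n Fs (aval u s) (aval v s))"
proof -
  consider "n \<le> aval u s" | "aval u s < n" "n \<le> aval v s" "aval v s < n + length Fs"
    | "aval u s < n" "\<not> (n \<le> aval v s \<and> aval v s < n + length Fs)" by linarith
  then show ?thesis
  proof cases
    case 2
    \<comment> \<open>Only in this case must the address lie inside the incidence matrix; otherwise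
      another factor is zero, whatever the cell holds.\<close>
    then have "input (encode_set_cover n Fs t) 0 (3 + ((aval v s - n) * n + aval u s)) =
        of_bool (aval u s \<in> Fs ! (aval v s - n))"
      by (intro input_encode_set_cover_entry) auto
    then show ?thesis using 2
      by (simp add: edge_exp_def cover_edge_def assms input_encode_set_cover)
  qed (auto simp: edge_exp_def cover_edge_def assms input_encode_set_cover)
qed

lemma aval_entry_exp:
  assumes "s x = input (encode_set_cover n Fs t) 0"
    and "aval j s < n + 3 * length Fs + (n + 3 * length Fs) * (n + 3 * length Fs)"
  shows "aval (entry_exp x j) s =
    encode_hub_graph (n + 3 * length Fs) (cover_graph n Fs) {..<n} ! aval j s"
proof -
  define N where "N = n + 3 * length Fs"
  define k where "k = aval j s - N"
  have N: "aval (order_exp x) s = N" using aval_order_exp[of s x, OF assms(1)] by (simp add: N_def)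
  have x0: "s x 0 = n" using assms(1) by (simp add: input_encode_set_cover)
  show ?thesis
  proof (cases "aval j s < N")
    case True
    then show ?thesis using assms(2)
      by (simp add: entry_exp_def Let_def N x0 nth_encode_hub_graph flip: N_def)
  next
    case False
    then have "k < N * N" using assms(2) by (simp add: k_def N_def)
    then have "k div N < N" "k mod N < N"
      using less_mult_imp_div_less by (auto intro!: mod_less_divisor intro: gr0I)
    moreover have "k - k div N * N = k mod N" by (simp add: minus_div_mult_eq_mod)
    ultimately show ?thesis using False assms(2)
      by (simp add: entry_exp_def adjacency_exp_def Let_def N nth_encode_hub_graph
          aval_edge_exp[of s x, OF assms(1)] flip: N_def k_def)
  qed
qed

lemma aval_cell_exp:
  assumes "s x = input (encode_set_cover n Fs t) 0" "h \<in> {1, 2}"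
    and "aval i s < length (hub_input h n Fs t)"
  shows "aval (cell_exp h x i) s = hub_input h n Fs t ! aval i s"
proof -
  let ?N = "n + 3 * length Fs"
  note [simp] = aval_order_exp[of s x, OF assms(1)] aval_budget_exp[of s x, OF assms(1)]
  have len: "length (take h [?N, length Fs + t]) = h" using assms(2) by auto
  show ?thesis
  proof (cases "aval i s < h")
    case True
    then show ?thesis using assms(2) by (auto simp: cell_exp_def hub_input_def less_2_cases_iff)
  next
    case False
    then have "aval (Op Sub i (Const h)) s < ?N + ?N * ?N"
      using assms(3) len by (simp add: hub_input_def length_encode_hub_graph)
    from aval_entry_exp[of s x, OF assms(1) this]
    have "aval (entry_exp x (Op Sub i (Const h))) s = hub_input h n Fs t ! aval i s"
      using False len by (simp add: hub_input_def nth_append)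
    then show ?thesis using False assms(2) by (auto simp: cell_exp_def)
  qed
qed

text \<open>The set cover instance is saved in array \<open>x\<close>; array \<open>x + 1\<close> holds the loop counter.\<close>

definition copy_input :: "nat \<Rightarrow> com" where
  "copy_input x = for_loop (x + 1) (Op Add (Const 3) (Op Mul (Read 0 (Const 1)) (Var 0)))
     x (Var (x + 1)) (Read 0 (Var (x + 1)))"

definition write_hub_input :: "nat \<Rightarrow> nat \<Rightarrow> com" where
  "write_hub_input h x = for_loop (x + 1)
     (Op Add (Const h) (Op Add (order_exp x) (Op Mul (order_exp x) (order_exp x))))
     0 (Var (x + 1)) (cell_exp h x (Var (x + 1)))"

text \<open>With \<open>N\<close> vertices, both the numbers of rounds and the lengths of all cells
  are bounded by \<open>(N + 3)\<^sup>2\<close>, whence the fourth power. The constant comes from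
  the expressions alone, and \<open>t \<le> length Fs\<close> keeps the budgets small.\<close>

lemma exec_reduction:
  assumes "2 \<le> x" "h \<in> {1, 2}"
  shows "\<exists>C. \<forall>n Fs t. t \<le> length Fs \<longrightarrow> (\<exists>T s.
    exec (Seq (copy_input x) (write_hub_input h x)) (input (encode_set_cover n Fs t)) T s \<and>
    T \<le> C * (n + 3 * length Fs + 3) ^ 4 \<and>
    s 0 = input (hub_input h n Fs t) 0 \<and> s x = input (encode_set_cover n Fs t) 0 \<and>
    (\<forall>a. a \<notin> {0, x, x + 1} \<longrightarrow> s a = (\<lambda>_. 0)) \<and>
    (\<forall>a i. blen (s a i) \<le> (n + 3 * length Fs + 3)\<^sup>2))"
proof -
  define C1 where "C1 = loop_weight (Op Add (Const 3) (Op Mul (Read 0 (Const 1)) (Var 0)))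
    (Var (x + 1)) (Read 0 (Var (x + 1)))"
  define C2 where "C2 = loop_weight
    (Op Add (Const h) (Op Add (order_exp x) (Op Mul (order_exp x) (order_exp x))))
    (Var (x + 1)) (cell_exp h x (Var (x + 1)))"
  have "\<exists>T s. exec (Seq (copy_input x) (write_hub_input h x)) (input (encode_set_cover n Fs t)) T s \<and>
    T \<le> (C1 + C2) * (n + 3 * length Fs + 3) ^ 4 \<and>
    s 0 = input (hub_input h n Fs t) 0 \<and> s x = input (encode_set_cover n Fs t) 0 \<and>
    (\<forall>a. a \<notin> {0, x, x + 1} \<longrightarrow> s a = (\<lambda>_. 0)) \<and>
    (\<forall>a i. blen (s a i) \<le> (n + 3 * length Fs + 3)\<^sup>2)" if "t \<le> length Fs" for n Fs t
  proof -
    define N where "N = n + 3 * length Fs"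
    define B where "B = (N + 3)\<^sup>2"
    have B: "B = N * N + 6 * N + 9" by (simp add: B_def power2_eq_square algebra_simps)
    let ?enc = "encode_set_cover n Fs t"
    let ?hub = "hub_input h n Fs t"
    define l1 where "l1 = length ?enc"
    define l2 where "l2 = length ?hub"
    have l2: "l2 = h + (N + N * N)"
      using assms(2) by (auto simp: l2_def hub_input_def length_encode_hub_graph N_def)
    have l1: "l1 = 3 + length Fs * n" by (simp add: l1_def length_encode_set_cover)
    have "length Fs * n \<le> N * N" unfolding N_def by (intro mult_le_mono) simp_all
    then have "l1 < B" by (simp add: l1 B)
    have "l2 < B" using assms(2) by (auto simp: l2 B)
    \<comment> \<open>The new input has to overwrite all of the old one in array 0. For
      \<open>N = 0\<close> it may be shorter, but then the old cells are all zero.\<close>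
    have l1_le: "l1 \<le> l2 \<or> N = 0"
    proof (cases "length Fs * n = 0")
      case True
      then show ?thesis using assms(2) by (cases N) (auto simp: l1 l2)
    next
      case False
      then have "3 \<le> N" by (cases Fs) (auto simp: N_def)
      then show ?thesis using \<open>length Fs * n \<le> N * N\<close> by (simp add: l1 l2)
    qed
    have enc_le: "input ?enc a i \<le> N + 1" for a i
    proof (cases "a = 0 \<and> i < length ?enc")
      case True
      then have "input ?enc a i \<in> {n, length Fs, t, 0, 1}"
        using subsetD[OF set_encode_set_cover nth_mem, of i n Fs t] by (simp add: input_def)
      then show ?thesis using that by (auto simp: N_def)
    qed (auto simp: input_def)
    have hub_le: "input ?hub 0 i \<le> N + 1" for i
    proof (cases "i < length ?hub")
      case True
      have sub: "set ?hub \<subseteq> {N, length Fs + t, 0, 1}"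
        using set_encode_hub_graph[of N "cover_graph n Fs" "{..<n}"]
          set_take_subset[of h "[N, length Fs + t]"] by (auto simp: hub_input_def N_def)
      have "input ?hub 0 i \<in> {N, length Fs + t, 0, 1}"
        using True subsetD[OF sub nth_mem[OF True]] by (simp add: input_def)
      then show ?thesis using that by (auto simp: N_def)
    qed (auto simp: input_def)
    have blen_B: "blen y \<le> B" if "y \<le> N + 1" for y using that by (intro blen_le) (simp add: B)
    define s1 where "s1 = (input ?enc)(x + 1 := (input ?enc (x + 1))(0 := l1), x := input ?enc 0)"
    have "\<exists>T. exec (copy_input x) (input ?enc) T s1 \<and> T \<le> C1 * (l1 + 1) * B"
    proof -
      define g where "g k = (\<lambda>i. if i < k then input ?enc 0 i else 0)" for k
      have "\<exists>T. exec (copy_input x) (input ?enc) T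
          ((input ?enc)(x + 1 := (input ?enc (x + 1))(0 := l1), x := g l1)) \<and> T \<le> C1 * (l1 + 1) * B"
        unfolding copy_input_def C1_def
      proof (rule exec_for_loop)
        show "g 0 = input ?enc x" using assms(1) by (simp add: g_def input_neq_0)
        show "blen l1 \<le> B" using \<open>l1 < B\<close> by (rule blen_le)
      qed (use assms(1) enc_le in \<open>auto simp: g_def fun_eq_iff l1 input_encode_set_cover less_Suc_eq
        intro: blen_B\<close>)
      moreover have "g l1 = input ?enc 0" by (auto simp: g_def input_0 l1_def)
      ultimately show ?thesis by (simp add: s1_def)
    qed
    then obtain T1 where T1: "exec (copy_input x) (input ?enc) T1 s1" "T1 \<le> C1 * (l1 + 1) * B"
      by blast
    have s1_le: "s1 a i \<le> max l1 (N + 1)" for a i using enc_le[of a i] enc_le[of 0 i] by (auto simp: s1_def)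
    define s2 where "s2 = s1(x + 1 := (s1 (x + 1))(0 := l2), 0 := input ?hub 0)"
    have B_s1: "blen (s1 a i) \<le> B" for a i
      using s1_le[of a i] \<open>l1 < B\<close> by (intro blen_le) (simp add: B)
    have "\<exists>T. exec (write_hub_input h x) s1 T s2 \<and> T \<le> C2 * (l2 + 1) * B"
    proof -
      \<comment> \<open>Array 0 still holds the old input beyond the cells written so far; the
        expressions read the copy in array \<open>x\<close> instead.\<close>
      define g where "g k = (\<lambda>i. if i < k then input ?hub 0 i else input ?enc 0 i)" for k
      have sx: "(s1(x + 1 := f, 0 := f')) x = input ?enc 0" for f f'
        using assms(1) by (simp add: s1_def)
      have "\<exists>T. exec (write_hub_input h x) s1 T (s1(x + 1 := (s1 (x + 1))(0 := l2), 0 := g l2)) \<and>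
          T \<le> C2 * (l2 + 1) * B"
        unfolding write_hub_input_def C2_def
      proof (rule exec_for_loop)
        show "g 0 = s1 0" using assms(1) by (simp add: g_def s1_def)
        show "blen l2 \<le> B" using \<open>l2 < B\<close> by (rule blen_le)
        show "blen (g k i) \<le> B" for k i using enc_le hub_le by (auto simp: g_def intro: blen_B)
        show "blen (s1 b i) \<le> B" for b i by (rule B_s1)
        show "aval (Op Add (Const h) (Op Add (order_exp x) (Op Mul (order_exp x) (order_exp x))))
            (s1(x + 1 := (s1 (x + 1))(0 := k), 0 := g k)) = l2" for k
          using aval_order_exp[of "s1(x + 1 := (s1 (x + 1))(0 := k), 0 := g k)" x, OF sx] by (simp add: l2 N_def)
        fix k assume "k < l2"
        let ?s = "s1(x + 1 := (s1 (x + 1))(0 := k), 0 := g k)"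
        have "aval (Var (x + 1)) ?s = k" by simp
        moreover from this have "aval (cell_exp h x (Var (x + 1))) ?s = ?hub ! k"
          using aval_cell_exp[of ?s x, OF sx assms(2)] \<open>k < l2\<close> unfolding l2_def by metis
        ultimately show "(g k)(aval (Var (x + 1)) ?s := aval (cell_exp h x (Var (x + 1))) ?s) = g (Suc k)"
          using \<open>k < l2\<close> by (auto simp: g_def fun_eq_iff less_Suc_eq input_0 l2_def)
      qed simp
      moreover have "g l2 = input ?hub 0"
      proof (cases "N = 0")
        case True
        then have "t = 0" "n = 0" "length Fs = 0" using that by (auto simp: N_def)
        then have "input ?enc 0 i = 0" for i
          by (auto simp: input_0 encode_set_cover_def nth_Cons')
        then show ?thesis by (auto simp: g_def fun_eq_iff input_0 l2_def)
      next
        case False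
        then show ?thesis using l1_le by (auto simp: g_def fun_eq_iff input_0 l1_def l2_def)
      qed
      ultimately show ?thesis by (simp add: s2_def)
    qed
    then obtain T2 where T2: "exec (write_hub_input h x) s1 T2 s2" "T2 \<le> C2 * (l2 + 1) * B"
      by blast
    have "T1 + T2 \<le> C1 * (l1 + 1) * B + C2 * (l2 + 1) * B" using T1(2) T2(2) by simp
    also have "\<dots> \<le> C1 * B * B + C2 * B * B"
      using \<open>l1 < B\<close> \<open>l2 < B\<close> by (intro add_mono mult_le_mono) simp_all
    also have "\<dots> = (C1 + C2) * (n + 3 * length Fs + 3) ^ 4"
      by (simp add: B_def N_def algebra_simps flip: power_add)
    finally have T: "T1 + T2 \<le> (C1 + C2) * (n + 3 * length Fs + 3) ^ 4" .
    have blen_s2: "blen (s2 a i) \<le> B" for a i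
      using B_s1[of a i] hub_le[of i] \<open>l2 < B\<close> blen_B blen_le[of l2 B] by (auto simp: s2_def)
    show ?thesis
    proof (intro exI conjI allI impI)
      show "exec (Seq (copy_input x) (write_hub_input h x)) (input ?enc) (T1 + T2) s2"
        by (rule exec.Seq[OF T1(1) T2(1)])
      show "T1 + T2 \<le> (C1 + C2) * (n + 3 * length Fs + 3) ^ 4" by (rule T)
      show "blen (s2 a i) \<le> (n + 3 * length Fs + 3)\<^sup>2" for a i
        using blen_s2 by (simp add: B_def N_def)
    qed (use assms(1) in \<open>auto simp: s2_def s1_def input_neq_0\<close>)
  qed
  then show ?thesis by blast
qed

section \<open>The reductions\<close>

text \<open>Below \<open>x\<close> the prepared state agrees with a fresh input, so \<open>P\<close>
  runs as it would alone and leaves arrays \<open>x\<close> and \<open>x + 2\<close> untouched.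
  Cells it writes have length at most \<open>T0\<close>.\<close>

lemma exec_reduction_then:
  assumes "2 \<le> x" "h \<in> {1, 2}" "com_arrays P \<subseteq> {..<x}"
  shows "\<exists>C. \<forall>n Fs t T0 s0. t \<le> length Fs \<and> exec P (input (hub_input h n Fs t)) T0 s0 \<longrightarrow> (\<exists>T s.
    exec (Seq (Seq (copy_input x) (write_hub_input h x)) P) (input (encode_set_cover n Fs t)) T s \<and>
    T \<le> C * (n + 3 * length Fs + 3) ^ 4 + T0 \<and>
    s 1 = s0 1 \<and> s x = input (encode_set_cover n Fs t) 0 \<and> s (x + 2) = (\<lambda>_. 0) \<and>
    (\<forall>a i. blen (s a i) \<le> (n + 3 * length Fs + 3)\<^sup>2 + T0))"
proof -
  obtain C where C: "\<And>n Fs t. t \<le> length Fs \<Longrightarrow> \<exists>T s.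
    exec (Seq (copy_input x) (write_hub_input h x)) (input (encode_set_cover n Fs t)) T s \<and>
    T \<le> C * (n + 3 * length Fs + 3) ^ 4 \<and>
    s 0 = input (hub_input h n Fs t) 0 \<and> s x = input (encode_set_cover n Fs t) 0 \<and>
    (\<forall>a. a \<notin> {0, x, x + 1} \<longrightarrow> s a = (\<lambda>_. 0)) \<and>
    (\<forall>a i. blen (s a i) \<le> (n + 3 * length Fs + 3)\<^sup>2)"
    using exec_reduction[OF assms(1,2)] by blast
  show ?thesis
  proof (rule exI[of _ C], intro allI impI, elim conjE)
    fix n t T0 :: nat and Fs :: "nat set list" and s0 :: state
    let ?enc = "input (encode_set_cover n Fs t)"
    assume "t \<le> length Fs" and P: "exec P (input (hub_input h n Fs t)) T0 s0"
    obtain T s where s: "exec (Seq (copy_input x) (write_hub_input h x)) ?enc T s"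
      "T \<le> C * (n + 3 * length Fs + 3) ^ 4"
      "s 0 = input (hub_input h n Fs t) 0" "s x = ?enc 0"
      "\<forall>a. a \<notin> {0, x, x + 1} \<longrightarrow> s a = (\<lambda>_. 0)"
      "\<forall>a i. blen (s a i) \<le> (n + 3 * length Fs + 3)\<^sup>2"
      using C[OF \<open>t \<le> length Fs\<close>, of n] by blast
    have "\<forall>a\<in>{..<x}. input (hub_input h n Fs t) a = s a"
    proof
      fix a assume "a \<in> {..<x}"
      then show "input (hub_input h n Fs t) a = s a"
        using s(3,5) by (cases "a = 0") (auto simp: input_neq_0)
    qed
    then obtain s' where s': "exec P s T0 s'" "\<forall>a\<in>{..<x}. s0 a = s' a"
      "\<forall>a. a \<notin> {..<x} \<longrightarrow> s' a = s a"
      using exec_frame[OF P assms(3)] by blast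
    show "\<exists>T s. exec (Seq (Seq (copy_input x) (write_hub_input h x)) P) ?enc T s \<and>
      T \<le> C * (n + 3 * length Fs + 3) ^ 4 + T0 \<and>
      s 1 = s0 1 \<and> s x = ?enc 0 \<and> s (x + 2) = (\<lambda>_. 0) \<and>
      (\<forall>a i. blen (s a i) \<le> (n + 3 * length Fs + 3)\<^sup>2 + T0)"
    proof (intro exI conjI allI)
      show "exec (Seq (Seq (copy_input x) (write_hub_input h x)) P) ?enc (T + T0) s'"
        by (rule exec.Seq[OF s(1) s'(1)])
      show "blen (s' a i) \<le> (n + 3 * length Fs + 3)\<^sup>2 + T0" for a i
        using exec_blen_le_time[OF s'(1), of a i] s(6) by (metis trans_le_add1 trans_le_add2)
    qed (use s s' assms(1) in auto)
  qed
qed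

text \<open>Turns additive overhead into a factor, the form of bound that both reductions
  share.\<close>

lemma add_le_overhead:
  fixes T :: nat
  assumes "T \<le> C * M + T0" "1 \<le> M"
  shows "T \<le> (C + 1) * M * (T0 + 1)"
proof -
  have "T0 \<le> M * T0" using assms(2) by simp
  moreover have "(C + 1) * M * (T0 + 1) = C * M + M * T0 + M + C * M * T0"
    by (simp add: algebra_simps)
  ultimately show ?thesis using assms(1) by linarith
qed

text \<open>The question asked is whether \<open>length Fs + t\<close> vertices dominate the graph,
  a legal budget since \<open>t \<le> length Fs\<close>. The first argument of \<open>time\<close>
  is \<open>n\<close>, the size of the hub.\<close>

lemma decision_reduction:
  assumes "decides_dominating_set 3 d P time"
  shows "\<exists>P' C. \<forall>n Fs t.
    set_cover_instance d {..<n} (set Fs) \<and> distinct Fs \<and> t \<le> length Fs \<longrightarrow>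
    (\<exists>T s T0. exec P' (input (encode_set_cover n Fs t)) T s \<and>
       T \<le> C * (n + 3 * length Fs + 3) ^ 4 * (T0 + 1) \<and>
       real T0 \<le> time n (n + 3 * length Fs) \<and>
       (accepting s \<longleftrightarrow> has_set_cover {..<n} (set Fs) t))"
proof -
  obtain x where x: "2 \<le> x" "com_arrays P \<subseteq> {..<x}" using ex_fresh_array by blast
  obtain C where C: "\<And>n Fs t T0 s0.
      t \<le> length Fs \<Longrightarrow> exec P (input (hub_input 2 n Fs t)) T0 s0 \<Longrightarrow> \<exists>T s.
    exec (Seq (Seq (copy_input x) (write_hub_input 2 x)) P) (input (encode_set_cover n Fs t)) T s \<and>
    T \<le> C * (n + 3 * length Fs + 3) ^ 4 + T0 \<and> s 1 = s0 1"
    using exec_reduction_then[OF x(1) _ x(2), of 2] by (metis insertCI)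
  show ?thesis
  proof (rule exI[of _ "Seq (Seq (copy_input x) (write_hub_input 2 x)) P"], rule exI[of _ "C + 1"],
      intro allI impI, elim conjE)
    fix n t :: nat and Fs :: "nat set list"
    let ?N = "n + 3 * length Fs"
    assume inst: "set_cover_instance d {..<n} (set Fs)" "distinct Fs" "t \<le> length Fs"
    have "input (?N # (length Fs + t) # encode_hub_graph ?N (cover_graph n Fs) {..<n}) =
        input (hub_input 2 n Fs t)"
      by (simp add: hub_input_def)
    moreover have "length Fs + t \<le> ?N" using inst(3) by simp
    ultimately obtain T0 s0 where s0: "exec P (input (hub_input 2 n Fs t)) T0 s0"
      "real T0 \<le> time n ?N"
      "accepting s0 \<longleftrightarrow> (\<exists>X. dominating_set (cover_graph n Fs) X \<and> card X \<le> length Fs + t)"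
      using assms hub_instance_cover_graph[OF inst(1)] unfolding decides_dominating_set_def
      by (metis card_lessThan)
    obtain T s where s: "exec (Seq (Seq (copy_input x) (write_hub_input 2 x)) P)
        (input (encode_set_cover n Fs t)) T s"
      "T \<le> C * (?N + 3) ^ 4 + T0" "s 1 = s0 1"
      using C[OF inst(3) s0(1)] by blast
    have "T \<le> (C + 1) * (?N + 3) ^ 4 * (T0 + 1)"
      by (rule add_le_overhead[OF s(2)]) simp
    moreover have "accepting s \<longleftrightarrow> has_set_cover {..<n} (set Fs) t"
      using s0(3) s(3) dominating_set_of_set_cover[OF inst(1,2)] set_cover_of_dominating_set[OF inst(1)]
      by (auto simp: accepting_def)
    ultimately show "\<exists>T s T0. exec (Seq (Seq (copy_input x) (write_hub_input 2 x)) P)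
        (input (encode_set_cover n Fs t)) T s \<and> T \<le> (C + 1) * (?N + 3) ^ 4 * (T0 + 1) \<and>
        real T0 \<le> time n ?N \<and> (accepting s \<longleftrightarrow> has_set_cover {..<n} (set Fs) t)"
      using s(1) s0(2) by blast
  qed
qed

text \<open>Array \<open>x + 2\<close> receives the numbers of vertices below \<open>0, 1, \<dots>\<close> in the set found.\<close>

definition count_output :: "nat \<Rightarrow> com" where
  "count_output x = for_loop (x + 1) (order_exp x) (x + 2) (Op Add (Var (x + 1)) (Const 1))
     (Op Add (Read (x + 2) (Var (x + 1))) (Op Less (Const 0) (Read 1 (Var (x + 1)))))"

text \<open>Comparison is strict on the machine, hence the budget plus one. The verdict overwrites a
  cell of the set found, which has been counted by then.\<close>

definition compare_count :: "nat \<Rightarrow> com" where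
  "compare_count x = Write 1 (Const 0)
     (Op Less (Read (x + 2) (order_exp x)) (Op Add (budget_exp x) (Const 1)))"

lemma exec_count_compare:
  assumes "2 \<le> x"
  shows "\<exists>C. \<forall>n Fs t s B. s x = input (encode_set_cover n Fs t) 0 \<and> s (x + 2) = (\<lambda>_. 0) \<and>
    (\<forall>a i. blen (s a i) \<le> B) \<and> n + 3 * length Fs < B \<longrightarrow>
    (\<exists>T s'. exec (Seq (count_output x) (compare_count x)) s T s' \<and>
       T \<le> C * (n + 3 * length Fs + 1) * B \<and>
       (accepting s' \<longleftrightarrow> card (output_set (n + 3 * length Fs) s) \<le> length Fs + t))"
proof -
  define C1 where "C1 = loop_weight (order_exp x) (Op Add (Var (x + 1)) (Const 1))
     (Op Add (Read (x + 2) (Var (x + 1))) (Op Less (Const 0) (Read 1 (Var (x + 1)))))"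
  define C2 where "C2 = weight (Const 0) +
    weight (Op Less (Read (x + 2) (order_exp x)) (Op Add (budget_exp x) (Const 1)))"
  have "\<exists>T s'. exec (Seq (count_output x) (compare_count x)) s T s' \<and>
       T \<le> (C1 + C2) * (n + 3 * length Fs + 1) * B \<and>
       (accepting s' \<longleftrightarrow> card (output_set (n + 3 * length Fs) s) \<le> length Fs + t)"
    if sx: "s x = input (encode_set_cover n Fs t) 0" and sx2: "s (x + 2) = (\<lambda>_. 0)"
      and Bs: "\<And>a i. blen (s a i) \<le> B" and BN: "n + 3 * length Fs < B" for n Fs t s B
  proof -
    define N where "N = n + 3 * length Fs"
    \<comment> \<open>Prefix counts: round \<open>k\<close> computes cell \<open>k + 1\<close> from
      cell \<open>k\<close>, starting from the zero already in cell 0.\<close>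
    define g where "g k = (\<lambda>i. if i \<le> k then card (output_set i s) else 0)" for k
    have output_set_Suc: "output_set (Suc k) s =
        (if s 1 k \<noteq> 0 then insert k (output_set k s) else output_set k s)" for k
      by (auto simp: output_set_def less_Suc_eq)
    have fin: "finite (output_set k s)" for k by (simp add: output_set_def)
    have card_Suc: "card (output_set (Suc k) s) = card (output_set k s) + of_bool (0 < s 1 k)" for k
      by (simp add: output_set_Suc fin) (simp add: output_set_def)
    have card_le: "card (output_set k s) \<le> k" for k
      by (induction k) (simp_all add: card_Suc, simp add: output_set_def)
    define s1 where "s1 = s(x + 1 := (s (x + 1))(0 := N), x + 2 := g N)"
    have "\<exists>T. exec (count_output x) s T s1 \<and> T \<le> C1 * (N + 1) * B"
      unfolding count_output_def C1_def s1_def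
    proof (rule exec_for_loop)
      show "g 0 = s (x + 2)" using sx2 by (auto simp: g_def output_set_def)
      show "blen N \<le> B" using BN by (intro blen_le) (simp add: N_def)
      show "blen (g k i) \<le> B" if "k \<le> N" for k i
      proof (rule blen_le)
        show "g k i < B" using card_le[of i] that BN by (auto simp: g_def N_def)
      qed
      show "aval (order_exp x) (s(x + 1 := (s (x + 1))(0 := k), x + 2 := g k)) = N" for k
        unfolding N_def by (rule aval_order_exp) (use sx in simp)
      show "(g k)(aval (Op Add (Var (x + 1)) (Const 1)) (s(x + 1 := (s (x + 1))(0 := k), x + 2 := g k)) :=
          aval (Op Add (Read (x + 2) (Var (x + 1))) (Op Less (Const 0) (Read 1 (Var (x + 1)))))
            (s(x + 1 := (s (x + 1))(0 := k), x + 2 := g k))) = g (Suc k)" for k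
        using assms by (auto simp: g_def fun_eq_iff card_Suc le_Suc_eq)
    qed (use Bs in auto)
    then obtain T1 where T1: "exec (count_output x) s T1 s1" "T1 \<le> C1 * (N + 1) * B" by blast
    have s1x: "s1 x = input (encode_set_cover n Fs t) 0" using sx by (simp add: s1_def)
    have B_s1: "blen (s1 a i) \<le> B" for a i
    proof -
      have "blen N \<le> B" "blen (g N i) \<le> B"
        using BN card_le[of i] by (auto simp: N_def g_def intro!: blen_le)
      then show ?thesis using Bs by (simp add: s1_def)
    qed
    let ?e = "Op Less (Read (x + 2) (order_exp x)) (Op Add (budget_exp x) (Const 1))"
    have "aval ?e s1 = of_bool (card (output_set N s) \<le> length Fs + t)"
      using aval_order_exp[of s1 x, OF s1x] aval_budget_exp[of s1 x, OF s1x]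
      by (simp add: s1_def g_def less_Suc_eq_le flip: N_def)
    then obtain T2 where T2: "exec (compare_count x) s1 T2
        (s1(1 := (s1 1)(0 := of_bool (card (output_set N s) \<le> length Fs + t))))" "T2 \<le> C2 * B"
      unfolding compare_count_def C2_def using exec_Write[of "Const 0" s1 0 ?e _ B 1] B_s1 by fastforce
    have "T1 + T2 \<le> C1 * (N + 1) * B + C2 * B" using T1(2) T2(2) by simp
    also have "\<dots> \<le> (C1 + C2) * (N + 1) * B" by (simp add: algebra_simps)
    finally have "T1 + T2 \<le> (C1 + C2) * (N + 1) * B" .
    then show ?thesis using exec.Seq[OF T1(1) T2(1)]
      by (intro exI conjI) (assumption, simp add: N_def, simp add: accepting_def N_def)
  qed
  then show ?thesis by blast
qed

text \<open>A minimum dominating set meets the budget iff some dominating set does, so it suffices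
  to count the vertices found and compare.\<close>

lemma search_reduction:
  assumes "solves_dominating_set 3 d P time"
  shows "\<exists>P' C. \<forall>n Fs t.
    set_cover_instance d {..<n} (set Fs) \<and> distinct Fs \<and> t \<le> length Fs \<longrightarrow>
    (\<exists>T s T0. exec P' (input (encode_set_cover n Fs t)) T s \<and>
       T \<le> C * (n + 3 * length Fs + 3) ^ 4 * (T0 + 1) \<and>
       real T0 \<le> time n (n + 3 * length Fs) \<and>
       (accepting s \<longleftrightarrow> has_set_cover {..<n} (set Fs) t))"
proof -
  obtain x where x: "2 \<le> x" "com_arrays P \<subseteq> {..<x}" using ex_fresh_array by blast
  let ?Q = "Seq (Seq (copy_input x) (write_hub_input 1 x)) P"
  let ?R = "Seq (count_output x) (compare_count x)"
  obtain C1 where C1: "\<forall>n Fs t T0 s0.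
      t \<le> length Fs \<and> exec P (input (hub_input 1 n Fs t)) T0 s0 \<longrightarrow> (\<exists>T s.
    exec ?Q (input (encode_set_cover n Fs t)) T s \<and>
    T \<le> C1 * (n + 3 * length Fs + 3) ^ 4 + T0 \<and>
    s 1 = s0 1 \<and> s x = input (encode_set_cover n Fs t) 0 \<and> s (x + 2) = (\<lambda>_. 0) \<and>
    (\<forall>a i. blen (s a i) \<le> (n + 3 * length Fs + 3)\<^sup>2 + T0))"
    using exec_reduction_then[OF x(1) _ x(2), of 1] by auto
  obtain C2 where C2: "\<forall>n Fs t s B. s x = input (encode_set_cover n Fs t) 0 \<and>
      s (x + 2) = (\<lambda>_. 0) \<and> (\<forall>a i. blen (s a i) \<le> B) \<and> n + 3 * length Fs < B \<longrightarrow>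
    (\<exists>T s'. exec ?R s T s' \<and> T \<le> C2 * (n + 3 * length Fs + 1) * B \<and>
       (accepting s' \<longleftrightarrow> card (output_set (n + 3 * length Fs) s) \<le> length Fs + t))"
    using exec_count_compare[OF x(1)] by blast
  show ?thesis
  proof (rule exI[of _ "Seq ?Q ?R"], rule exI[of _ "C1 + 1 + C2"], intro allI impI, elim conjE)
    fix n t :: nat and Fs :: "nat set list"
    let ?N = "n + 3 * length Fs"
    assume inst: "set_cover_instance d {..<n} (set Fs)" "distinct Fs" "t \<le> length Fs"
    have "input (?N # encode_hub_graph ?N (cover_graph n Fs) {..<n}) = input (hub_input 1 n Fs t)"
      by (simp add: hub_input_def)
    then obtain T0 s0 where s0: "exec P (input (hub_input 1 n Fs t)) T0 s0"
      "real T0 \<le> time n ?N" "minimum_dominating_set (cover_graph n Fs) (output_set ?N s0)"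
      using assms hub_instance_cover_graph[OF inst(1)] unfolding solves_dominating_set_def
      by (metis card_lessThan)
    \<comment> \<open>The summand \<open>T0\<close> allows for the numbers that \<open>P\<close> may
      have written.\<close>
    define B where "B = (?N + 3)\<^sup>2 + T0"
    obtain T s where s: "exec ?Q (input (encode_set_cover n Fs t)) T s"
      "T \<le> C1 * (?N + 3) ^ 4 + T0" "s 1 = s0 1"
      "s x = input (encode_set_cover n Fs t) 0" "s (x + 2) = (\<lambda>_. 0)" "\<forall>a i. blen (s a i) \<le> B"
      using C1[rule_format, of t Fs n T0 s0] inst(3) s0(1) unfolding B_def by blast
    have "?N + 3 \<le> (?N + 3)\<^sup>2" by (rule self_le_power) simp_all
    then have "?N < B" unfolding B_def by linarith
    then obtain T' s' where s': "exec ?R s T' s'" "T' \<le> C2 * (?N + 1) * B"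
      "accepting s' \<longleftrightarrow> card (output_set ?N s) \<le> length Fs + t"
      using C2[rule_format, of s n Fs t B] s(4-6) by blast
    have "B \<le> (?N + 3)\<^sup>2 * (T0 + 1)" by (simp add: B_def)
    then have "C2 * (?N + 1) * B \<le> C2 * (?N + 3)\<^sup>2 * ((?N + 3)\<^sup>2 * (T0 + 1))"
      using \<open>?N + 3 \<le> (?N + 3)\<^sup>2\<close> by (intro mult_le_mono) linarith+
    also have "\<dots> = C2 * (?N + 3) ^ 4 * (T0 + 1)" 
      by (simp only: mult.assoc power4_eq_xxxx power2_eq_square)
    finally have T': "T' \<le> C2 * (?N + 3) ^ 4 * (T0 + 1)" using s'(2) by linarith
    have "T \<le> (C1 + 1) * (?N + 3) ^ 4 * (T0 + 1)"
      by (rule add_le_overhead[OF s(2)]) simp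
    with T' have "T + T' \<le> (C1 + 1 + C2) * (?N + 3) ^ 4 * (T0 + 1)"
      unfolding distrib_right by linarith
    moreover have "output_set ?N s = output_set ?N s0" using s(3) by (simp add: output_set_def)
    then have "accepting s' \<longleftrightarrow> (\<exists>X. dominating_set (cover_graph n Fs) X \<and> card X \<le> length Fs + t)"
      using s0(3) s'(3) unfolding minimum_dominating_set_def by (metis le_trans)
    then have "accepting s' \<longleftrightarrow> has_set_cover {..<n} (set Fs) t"
      using dominating_set_of_set_cover[OF inst(1,2)] set_cover_of_dominating_set[OF inst(1)] by blast
    ultimately show "\<exists>T s T0. exec (Seq ?Q ?R) (input (encode_set_cover n Fs t)) T s \<and>
        T \<le> (C1 + 1 + C2) * (?N + 3) ^ 4 * (T0 + 1) \<and>
        real T0 \<le> time n ?N \<and> (accepting s \<longleftrightarrow> has_set_cover {..<n} (set Fs) t)"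
      using exec.Seq[OF s(1) s'(1)] s0(2) by blast
  qed
qed

section \<open>From the reductions to the lower bound\<close>

text \<open>The exponential factor has exponent \<open>n\<close> on both sides, and all other
  factors are polynomial in \<open>n\<close> for fixed \<open>d\<close>.\<close>

lemma solves_set_cover_of_reduction:
  fixes b K :: real
  assumes "1 \<le> b" "0 \<le> K"
    and red: "\<And>n Fs t. set_cover_instance d {..<n} (set Fs) \<Longrightarrow> distinct Fs \<Longrightarrow> t \<le> length Fs \<Longrightarrow>
      \<exists>T s T0. exec P (input (encode_set_cover n Fs t)) T s \<and>
        T \<le> C * (n + 3 * length Fs + 3) ^ 4 * (T0 + 1) \<and>
        real T0 \<le> b ^ n * (K * (real (n + 3 * length Fs) + 1) ^ c) \<and>
        (accepting s \<longleftrightarrow> has_set_cover {..<n} (set Fs) t)"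
  shows "\<exists>K' c'. solves_set_cover d P (\<lambda>n. b ^ n * (K' * (real n + 1) ^ c'))"
proof (intro exI)
  \<comment> \<open>Powers \<open>4\<close> of the overhead and \<open>c\<close> of the time bound
    apply to \<open>?N + 3 \<le> 6 * (n + 1) ^ (d + 1)\<close>.\<close>
  let ?K = "real C * 6 ^ (4 + c) * (K + 1)"
  let ?c = "(d + 1) * (4 + c)"
  show "solves_set_cover d P (\<lambda>n. b ^ n * (?K * (real n + 1) ^ ?c))"
    unfolding solves_set_cover_def
  proof (intro allI impI, elim conjE)
    fix n t :: nat and Fs :: "nat set list"
    let ?N = "n + 3 * length Fs"
    assume inst: "set_cover_instance d {..<n} (set Fs)" "distinct Fs" "t \<le> length Fs"
    obtain T s T0 where s: "exec P (input (encode_set_cover n Fs t)) T s"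
        "T \<le> C * (?N + 3) ^ 4 * (T0 + 1)"
        "real T0 \<le> b ^ n * (K * (real ?N + 1) ^ c)"
        "accepting s \<longleftrightarrow> has_set_cover {..<n} (set Fs) t"
      using red[OF inst] by blast
    define Y where "Y = real ?N + 3"
    have "length Fs \<le> (n + 1) ^ d" by (rule length_set_cover_family_le[OF inst(1,2)])
    \<comment> \<open>With exponent \<open>d + 1\<close> the power also dominates
      \<open>n + 1\<close> when \<open>d = 0\<close>. The 6 is 3 for the paths, 1 for
      \<open>n + 1\<close> and 2 for the rest.\<close>
    also have "\<dots> \<le> (n + 1) ^ (d + 1)" by (rule power_increasing) simp_all
    finally have "length Fs \<le> (n + 1) ^ (d + 1)" .
    moreover have "n + 1 \<le> (n + 1) ^ (d + 1)" by (rule self_le_power) simp_all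
    ultimately have "?N + 3 \<le> 6 * (n + 1) ^ (d + 1)" by linarith
    then have "real (?N + 3) \<le> real (6 * (n + 1) ^ (d + 1))" by (rule of_nat_mono)
    also have "\<dots> = 6 * (real n + 1) ^ (d + 1)" by (simp add: algebra_simps)
    finally have Y: "Y \<le> 6 * (real n + 1) ^ (d + 1)" by (simp add: Y_def)
    have "1 \<le> Y" by (simp add: Y_def)
    have bn: "1 \<le> b ^ n" using assms(1) by simp
    have Yc: "1 \<le> Y ^ c" using \<open>1 \<le> Y\<close> by simp
    have "(real ?N + 1) ^ c \<le> Y ^ c" by (intro power_mono) (simp_all add: Y_def)
    then have "b ^ n * (K * (real ?N + 1) ^ c) \<le> b ^ n * (K * Y ^ c)"
      using assms(2) bn by (intro mult_left_mono) auto
    \<comment> \<open>This absorbs the 1 in \<open>T0 + 1\<close> at the price of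
      \<open>K + 1\<close> for \<open>K\<close>.\<close>
    moreover have "1 * 1 \<le> b ^ n * Y ^ c" using bn Yc by (intro mult_mono) auto
    ultimately have T0: "real T0 + 1 \<le> b ^ n * (K + 1) * Y ^ c" using s(3) by (simp add: algebra_simps)
    have "real T \<le> real (C * (?N + 3) ^ 4 * (T0 + 1))" using s(2) by (rule of_nat_mono)
    also have "\<dots> = real C * Y ^ 4 * (real T0 + 1)" by (simp add: Y_def algebra_simps)
    also have "\<dots> \<le> real C * Y ^ 4 * (b ^ n * (K + 1) * Y ^ c)"
      using T0 \<open>1 \<le> Y\<close> by (intro mult_left_mono) auto
    also have "\<dots> = b ^ n * (real C * (K + 1) * Y ^ (4 + c))" by (simp add: power_add algebra_simps)
    also have "\<dots> \<le> b ^ n * (real C * (K + 1) * (6 * (real n + 1) ^ (d + 1)) ^ (4 + c))"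
      using Y \<open>1 \<le> Y\<close> bn assms(2) by (intro mult_left_mono power_mono) auto
    also have "\<dots> = b ^ n * (?K * (real n + 1) ^ ?c)"
      by (simp only: power_mult_distrib power_mult) (simp add: algebra_simps)
    finally show "\<exists>T s. exec P (input (encode_set_cover n Fs t)) T s \<and>
        real T \<le> b ^ n * (?K * (real n + 1) ^ ?c) \<and>
        (accepting s \<longleftrightarrow> has_set_cover {..<n} (set Fs) t)"
      using s(1,4) by blast
  qed
qed

text \<open>The instances with zero and with one element force \<open>K > 0\<close> and \<open>b K > 0\<close>.\<close>

lemma positive_base_of_time_bound:
  fixes b K :: real
  assumes "\<And>n G Q. hub_instance 3 1 n G Q \<Longrightarrow> \<exists>T>0. real T \<le> b ^ card Q * (K * (real n + 1) ^ c)"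
  shows "0 < b"
proof -
  have "hub_instance 3 1 0 (cover_graph 0 []) {}"
    using hub_instance_cover_graph[of 1 0 "[]"] by (simp add: set_cover_instance_def)
  then obtain T0 :: nat where "T0 > 0" "real T0 \<le> K" using assms[of 0 _ "{}"] by fastforce
  then have "0 < K" by linarith
  have "hub_instance 3 1 4 (cover_graph 1 [{0}]) {..<1}"
    using hub_instance_cover_graph[of 1 1 "[{0}]"] by (simp add: set_cover_instance_def lessThan_Suc)
  then obtain T1 :: nat where "T1 > 0" "real T1 \<le> b * (K * 5 ^ c)"
    using assms[of 4 _ "{..<1}"] by fastforce
  then have "0 < b * (K * 5 ^ c)" by linarith
  then show ?thesis by (rule zero_less_mult_pos2) (use \<open>0 < K\<close> in simp)
qed

text \<open>For \<open>\<epsilon> < 2\<close> the set size bound given by \<open>SCC\<close> serves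
  as \<open>\<delta>\<close> for both versions. For larger \<open>\<epsilon>\<close> the base is not
  positive, so the time bound itself is impossible.\<close>

theorem theorem10p1:
  assumes SCC
  shows "\<forall>\<epsilon>>0. \<exists>\<delta>.
    \<not> (\<exists>P (K::real) (c::nat). solves_dominating_set 3 \<delta> P
          (\<lambda>p n. (2 - \<epsilon>) ^ p * (K * (real n + 1) ^ c))) \<and>
    \<not> (\<exists>P (K::real) (c::nat). decides_dominating_set 3 \<delta> P
          (\<lambda>p n. (2 - \<epsilon>) ^ p * (K * (real n + 1) ^ c)))"
proof (intro allI impI)
  fix \<epsilon> :: real assume "\<epsilon> > 0"
  show "\<exists>\<delta>.
    \<not> (\<exists>P (K::real) (c::nat). solves_dominating_set 3 \<delta> P
          (\<lambda>p n. (2 - \<epsilon>) ^ p * (K * (real n + 1) ^ c))) \<and>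
    \<not> (\<exists>P (K::real) (c::nat). decides_dominating_set 3 \<delta> P
          (\<lambda>p n. (2 - \<epsilon>) ^ p * (K * (real n + 1) ^ c)))"
  proof (cases "\<epsilon> < 2")
    case True
    \<comment> \<open>The reduction needs a base of at least 1; applying \<open>SCC\<close> to
      \<open>min \<epsilon> 1\<close> provides one.\<close>
    define b where "b = 2 - min \<epsilon> 1"
    have b: "1 \<le> b" "0 \<le> 2 - \<epsilon>" "2 - \<epsilon> \<le> b" using True by (auto simp: b_def)
    obtain d where d: "\<nexists>P (K::real) (c::nat). solves_set_cover d P (\<lambda>n. b ^ n * (K * (real n + 1) ^ c))"
      using assms \<open>\<epsilon> > 0\<close> unfolding SCC_def b_def by (metis min_less_iff_conj zero_less_one)
    \<comment> \<open>The constant of a time bound may be negative a priori, hence the absolute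
      value.\<close>
    have time_le: "(2 - \<epsilon>) ^ p * (K * (real N + 1) ^ c) \<le> b ^ p * (\<bar>K\<bar> * (real N + 1) ^ c)"
      for p N c and K :: real
    proof -
      have "(2 - \<epsilon>) ^ p * (K * (real N + 1) ^ c) \<le> (2 - \<epsilon>) ^ p * (\<bar>K\<bar> * (real N + 1) ^ c)"
        using b(2) by (intro mult_left_mono mult_right_mono) auto
      also have "\<dots> \<le> b ^ p * (\<bar>K\<bar> * (real N + 1) ^ c)"
        using b by (intro mult_right_mono power_mono) auto
      finally show ?thesis .
    qed
    have no_reduction: False if "\<forall>n Fs t.
        set_cover_instance d {..<n} (set Fs) \<and> distinct Fs \<and> t \<le> length Fs \<longrightarrow>
        (\<exists>T s T0. exec P' (input (encode_set_cover n Fs t)) T s \<and>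
           T \<le> C * (n + 3 * length Fs + 3) ^ 4 * (T0 + 1) \<and>
           real T0 \<le> (2 - \<epsilon>) ^ n * (K * (real (n + 3 * length Fs) + 1) ^ c) \<and>
           (accepting s \<longleftrightarrow> has_set_cover {..<n} (set Fs) t))" for P' C K c
    proof -
      have "\<exists>K' c'. solves_set_cover d P' (\<lambda>n. b ^ n * (K' * (real n + 1) ^ c'))"
      proof (rule solves_set_cover_of_reduction[OF b(1) abs_ge_zero[of K]])
        fix n t :: nat and Fs :: "nat set list"
        assume "set_cover_instance d {..<n} (set Fs)" "distinct Fs" "t \<le> length Fs"
        with that obtain T s T0 where "exec P' (input (encode_set_cover n Fs t)) T s"
           "T \<le> C * (n + 3 * length Fs + 3) ^ 4 * (T0 + 1)"
           "real T0 \<le> (2 - \<epsilon>) ^ n * (K * (real (n + 3 * length Fs) + 1) ^ c)"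
           "accepting s \<longleftrightarrow> has_set_cover {..<n} (set Fs) t" by blast
        then show "\<exists>T s T0. exec P' (input (encode_set_cover n Fs t)) T s \<and>
           T \<le> C * (n + 3 * length Fs + 3) ^ 4 * (T0 + 1) \<and>
           real T0 \<le> b ^ n * (\<bar>K\<bar> * (real (n + 3 * length Fs) + 1) ^ c) \<and>
           (accepting s \<longleftrightarrow> has_set_cover {..<n} (set Fs) t)"
          using time_le by (blast intro: order_trans)
      qed
      then show False using d by blast
    qed
    show ?thesis
    proof (intro exI[of _ d] conjI notI; elim exE)
      fix P K c
      assume "solves_dominating_set 3 d P (\<lambda>p n. (2 - \<epsilon>) ^ p * (K * (real n + 1) ^ c))"
      from search_reduction[OF this] show False using no_reduction by blast
    next
      fix P K c
      assume "decides_dominating_set 3 d P (\<lambda>p n. (2 - \<epsilon>) ^ p * (K * (real n + 1) ^ c))"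
      from decision_reduction[OF this] show False using no_reduction by blast
    qed
  next
    case False
    show ?thesis
    proof (intro exI[of _ 1] conjI notI; elim exE)
      fix P K c
      assume P: "solves_dominating_set 3 1 P (\<lambda>p n. (2 - \<epsilon>) ^ p * (K * (real n + 1) ^ c))"
      have "0 < 2 - \<epsilon>"
      proof (rule positive_base_of_time_bound)
        show "\<exists>T>0. real T \<le> (2 - \<epsilon>) ^ card Q * (K * (real n + 1) ^ c)"
          if "hub_instance 3 1 n G Q" for n G Q
          using P that unfolding solves_dominating_set_def by (meson exec_time_pos)
      qed
      with False show False by simp
    next
      fix P K c
      assume P: "decides_dominating_set 3 1 P (\<lambda>p n. (2 - \<epsilon>) ^ p * (K * (real n + 1) ^ c))"
      have "0 < 2 - \<epsilon>"
      proof (rule positive_base_of_time_bound)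
        show "\<exists>T>0. real T \<le> (2 - \<epsilon>) ^ card Q * (K * (real n + 1) ^ c)"
          if "hub_instance 3 1 n G Q" for n G Q
          using P that unfolding decides_dominating_set_def by (meson exec_time_pos le0)
      qed
      with False show False by simp
    qed
  qed
qed

end
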